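(* Let $I$ be a monomial ideal in $\Bbbk[\mathbb{N}A]$, let $F$ be a face of $A$, and suppose that $\mathfrak{p}_F$ is an associated prime of $I$. Then $\mathrm{mult}_I(\mathfrak{p}_F)$ equals the number of overlap classes of standard pairs of $I$ that belong to $F$.
   Context: Standing assumptions: $\mathbb{N}=\{0,1,2,\dots\}$; $\Bbbk$ is an infinite field; $A=\{a_1,\dots,a_n\}\subset\mathbb{Z}^d\setminus\{0\}$ is a fixed finite set. $\mathbb{N}A$, $\mathbb{Z}A$, $\mathbb{R}_{\ge 0}A$ denote respectively the monoid of nonnegative integer combinations, the group of integer combinations, and the cone of nonnegative real combinations of elements of $A$ (similarly for subsets of $A$). It is assumed that $\mathbb{Z}A=\mathbb{Z}^d$ and that the cone $\mathbb{R}_{\ge 0}A$ is strongly convex (contains no lines). $\Bbbk[\mathbb{N}A]$ is the subring of the Laurent polynomial ring $\Bbbk[t_1^{\pm1},\dots,t_d^{\pm1}]$ with $\Bbbk$-basis the monomials $t^a$, $a\in\mathbb{N}A$. A monomial ideal is an ideal of $\Bbbk[\mathbb{N}A]$ generated by monomials $t^a$, $a \in \mathbb{N}A$. A face of $A$ is a subset $F\subseteq A$ such that $\mathbb{R}_{\ge0}F$ is a face of the cone $\mathbb{R}_{\ge0}A$ and $\mathbb{R}_{\ge0}F\cap A=F$ (both $F=A$ and $F=\varnothing$, the latter corresponding to the origin, are allowed). For a face $F$, $\mathfrak{p}_F=\langle t^a\mid a\in\mathbb{N}A\setminus\mathbb{N}F\rangle$, a prime monomial ideal. A pair of $A$ is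 $(a,F)$ with $a\in\mathbb{N}A$ and $F$ a face of $A$; it is said to belong to $F$. Write $(a,F)\prec(b,G)$ if $a+\mathbb{N}F\subseteq b+\mathbb{N}G$. Pairs $(a,F)$ and $(b,F)$ overlap if $a-b\in\mathbb{Z}F$; this is an equivalence relation on pairs, and the class of $(a,F)$ is its overlap class. For a monomial ideal $I$, $\mathrm{std}(I)=\{a\in\mathbb{N}A\mid t^a\notin I\}$. A proper pair of $I$ is a pair $(a,F)$ with $a+\mathbb{N}F\subseteq\mathrm{std}(I)$. A standard pair of $I$ is a proper pair of $I$ that is maximal with respect to $\prec$ among proper pairs of $I$. An overlap class of standard pairs of $I$ is an overlap class containing at least one standard pair of $I$. For an associated prime $\mathfrak{p}_F$ of $I$, $\mathrm{mult}_I(\mathfrak{p}_F)$ is the length of the largest ideal of finite length in the local ring $\Bbbk[\mathbb{N}A]_{\mathfrak{p}_F}/I\,\Bbbk[\mathbb{N}A]_{\mathfrak{p}_F}$; this length is finite. *)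

theory Defs
  imports
    "HOL-Analysis.Polytope"
    "HOL-Algebra.QuotRing"
    "HOL-Library.Poly_Mapping"
    "HOL-Library.Extended_Nat"
begin

section \<open>Commutative algebra: localization, associated primes, length, multiplicity\<close>

text \<open>The ring of fractions of a commutative ring \<open>R\<close> with respect to a multiplicative set \<open>S\<close>.
  A fraction \<open>r/s\<close> is the class of \<open>(r, s)\<close>; the factor \<open>u\<close> is needed when
  \<open>S\<close> contains zero divisors.\<close>

definition frac_rel :: "('a, 'm) ring_scheme \<Rightarrow> 'a set \<Rightarrow> (('a \<times> 'a) \<times> ('a \<times> 'a)) set" where
  "frac_rel R S = {((r, s), (r', s')).
     r \<in> carrier R \<and> s \<in> S \<and> r' \<in> carrier R \<and> s' \<in> S \<and>
     (\<exists>u\<in>S. u \<otimes>\<^bsub>R\<^esub> (s' \<otimes>\<^bsub>R\<^esub> r \<ominus>\<^bsub>R\<^esub> s \<otimes>\<^bsub>R\<^esub> r') = \<zero>\<^bsub>R\<^esub>)}"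

definition fraction :: "('a, 'm) ring_scheme \<Rightarrow> 'a set \<Rightarrow> 'a \<Rightarrow> 'a \<Rightarrow> ('a \<times> 'a) set" where
  "fraction R S r s = frac_rel R S `` {(r, s)}"

definition ring_of_fractions :: "('a, 'm) ring_scheme \<Rightarrow> 'a set \<Rightarrow> ('a \<times> 'a) set ring" where
  "ring_of_fractions R S =
    \<lparr> carrier = (carrier R \<times> S) // frac_rel R S,
      mult = (\<lambda>X Y. \<Union>(r, s)\<in>X. \<Union>(r', s')\<in>Y. fraction R S (r \<otimes>\<^bsub>R\<^esub> r') (s \<otimes>\<^bsub>R\<^esub> s')),
      one = fraction R S \<one>\<^bsub>R\<^esub> \<one>\<^bsub>R\<^esub>,
      zero = fraction R S \<zero>\<^bsub>R\<^esub> \<one>\<^bsub>R\<^esub>,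
      add = (\<lambda>X Y. \<Union>(r, s)\<in>X. \<Union>(r', s')\<in>Y.
               fraction R S (s' \<otimes>\<^bsub>R\<^esub> r \<oplus>\<^bsub>R\<^esub> s \<otimes>\<^bsub>R\<^esub> r') (s \<otimes>\<^bsub>R\<^esub> s')) \<rparr>"

definition localization_at :: "('a, 'm) ring_scheme \<Rightarrow> 'a set \<Rightarrow> ('a \<times> 'a) set ring" where
  "localization_at R P = ring_of_fractions R (carrier R - P)"

definition localized_ideal :: "('a, 'm) ring_scheme \<Rightarrow> 'a set \<Rightarrow> 'a set \<Rightarrow> ('a \<times> 'a) set set" where
  "localized_ideal R P I =
     genideal (localization_at R P) ((\<lambda>r. fraction R (carrier R - P) r \<one>\<^bsub>R\<^esub>) ` I)"

text \<open>A prime ideal \<open>P\<close> that is the annihilator of some element \<open>f + I\<close> of the module \<open>R/I\<close>.\<close>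

definition associated_prime :: "('a, 'm) ring_scheme \<Rightarrow> 'a set \<Rightarrow> 'a set \<Rightarrow> bool" where
  "associated_prime R I P \<longleftrightarrow>
     primeideal P R \<and> (\<exists>f\<in>carrier R. P = {r \<in> carrier R. r \<otimes>\<^bsub>R\<^esub> f \<in> I})"

text \<open>The length of an ideal \<open>J\<close> of \<open>R\<close> as an \<open>R\<close>-module: the supremum of the lengths of strict
  chains of submodules, which are the ideals of \<open>R\<close> contained in \<open>J\<close>.\<close>

definition ideal_length :: "('a, 'm) ring_scheme \<Rightarrow> 'a set \<Rightarrow> enat" where
  "ideal_length R J =
     (SUP n \<in> {n. \<exists>C. (\<forall>i\<le>n. ideal (C i) R \<and> C i \<subseteq> J) \<and> (\<forall>i<n. C i \<subset> C (Suc i))}. enat n)"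

definition largest_finite_length_ideal :: "('a, 'm) ring_scheme \<Rightarrow> 'a set \<Rightarrow> bool" where
  "largest_finite_length_ideal R J \<longleftrightarrow>
     ideal J R \<and> ideal_length R J < \<infinity> \<and>
     (\<forall>K. ideal K R \<and> ideal_length R K < \<infinity> \<longrightarrow> K \<subseteq> J)"

text \<open>A largest ideal of finite length is unique by antisymmetry of inclusion; it exists whenever
  the ring is Noetherian.\<close>

definition multiplicity_at :: "('a, 'm) ring_scheme \<Rightarrow> 'a set \<Rightarrow> 'a set \<Rightarrow> enat" where
  "multiplicity_at R I P =
     (let Q = localization_at R P Quot localized_ideal R P I
      in ideal_length Q (THE J. largest_finite_length_ideal Q J))"


section \<open>Affine semigroups and their faces\<close>

text \<open>The spans below are meant for finite \<open>B\<close>; sums over infinite sets are \<open>0\<close>.\<close>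

definition nat_span :: "(int ^ 'd::finite) set \<Rightarrow> (int ^ 'd) set" where
  "nat_span B = {\<Sum>b\<in>B. int (c b) *s b | c. True}"

definition int_span :: "(int ^ 'd::finite) set \<Rightarrow> (int ^ 'd) set" where
  "int_span B = {\<Sum>b\<in>B. c b *s b | c. True}"

definition real_vec :: "int ^ 'd::finite \<Rightarrow> real ^ 'd" where
  "real_vec a = (\<chi> i. real_of_int (a $ i))"

definition real_cone :: "(int ^ 'd::finite) set \<Rightarrow> (real ^ 'd) set" where
  "real_cone B = {\<Sum>b\<in>B. c b *\<^sub>R real_vec b | c. \<forall>b\<in>B. 0 \<le> c b}"

definition contains_no_line :: "(real ^ 'd::finite) set \<Rightarrow> bool" where
  "contains_no_line C \<longleftrightarrow> \<not> (\<exists>x v. v \<noteq> 0 \<and> (\<forall>t. x + t *\<^sub>R v \<in> C))"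

text \<open>\<open>real_cone {}\<close> is the origin, so \<open>(face_of)\<close> is never applied to the empty cone face.\<close>

definition is_face :: "(int ^ 'd::finite) set \<Rightarrow> (int ^ 'd) set \<Rightarrow> bool" where
  "is_face A F \<longleftrightarrow>
     F \<subseteq> A \<and> real_cone F face_of real_cone A \<and> {a \<in> A. real_vec a \<in> real_cone F} = F"


section \<open>The semigroup ring and its monomial ideals\<close>

text \<open>The Laurent polynomial ring over \<open>'k\<close> in variables indexed by \<open>'d\<close> is the type of finitely
  supported functions from exponent vectors to coefficients, with convolution as product.\<close>

definition semigroup_ring :: "(int ^ 'd::finite) set \<Rightarrow> ((int ^ 'd) \<Rightarrow>\<^sub>0 'k::field) ring" where
  "semigroup_ring A =
    \<lparr> carrier = {p. Poly_Mapping.keys p \<subseteq> nat_span A},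
      mult = (*), one = 1, zero = 0, add = (+) \<rparr>"

abbreviation mon :: "int ^ 'd::finite \<Rightarrow> (int ^ 'd) \<Rightarrow>\<^sub>0 'k::field" where
  "mon a \<equiv> Poly_Mapping.single a 1"

definition monomial_ideal :: "(int ^ 'd::finite) set \<Rightarrow> ((int ^ 'd) \<Rightarrow>\<^sub>0 'k::field) set \<Rightarrow> bool" where
  "monomial_ideal A I \<longleftrightarrow> (\<exists>B\<subseteq>nat_span A. I = genideal (semigroup_ring A) (mon ` B))"

definition face_prime :: "(int ^ 'd::finite) set \<Rightarrow> (int ^ 'd) set \<Rightarrow> ((int ^ 'd) \<Rightarrow>\<^sub>0 'k::field) set" where
  "face_prime A F = genideal (semigroup_ring A) (mon ` (nat_span A - nat_span F))"


section \<open>Standard pairs and overlap classes\<close>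

type_synonym 'd pair = "(int ^ 'd) \<times> (int ^ 'd) set"

definition pairs :: "(int ^ 'd::finite) set \<Rightarrow> 'd pair set" where
  "pairs A = {(a, F). a \<in> nat_span A \<and> is_face A F}"

definition translate_of :: "'d::finite pair \<Rightarrow> (int ^ 'd) set" where
  "translate_of p = (+) (fst p) ` nat_span (snd p)"

definition pair_le :: "'d::finite pair \<Rightarrow> 'd pair \<Rightarrow> bool" where
  "pair_le p q \<longleftrightarrow> translate_of p \<subseteq> translate_of q"

definition std :: "(int ^ 'd::finite) set \<Rightarrow> ((int ^ 'd) \<Rightarrow>\<^sub>0 'k::field) set \<Rightarrow> (int ^ 'd) set" where
  "std A I = {a \<in> nat_span A. mon a \<notin> I}"

definition proper_pair ::
    "(int ^ 'd::finite) set \<Rightarrow> ((int ^ 'd) \<Rightarrow>\<^sub>0 'k::field) set \<Rightarrow> 'd pair \<Rightarrow> bool" where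
  "proper_pair A I p \<longleftrightarrow> p \<in> pairs A \<and> translate_of p \<subseteq> std A I"

definition standard_pair ::
    "(int ^ 'd::finite) set \<Rightarrow> ((int ^ 'd) \<Rightarrow>\<^sub>0 'k::field) set \<Rightarrow> 'd pair \<Rightarrow> bool" where
  "standard_pair A I p \<longleftrightarrow>
     proper_pair A I p \<and> (\<forall>q. proper_pair A I q \<and> pair_le p q \<longrightarrow> q = p)"

definition overlap :: "(int ^ 'd::finite) set \<Rightarrow> ('d pair \<times> 'd pair) set" where
  "overlap A = {(p, q). p \<in> pairs A \<and> q \<in> pairs A \<and>
                        snd p = snd q \<and> fst p - fst q \<in> int_span (snd p)}"

text \<open>An overlap class is a class of arbitrary pairs; only one member need be standard.
  All members of a class belong to the same face.\<close>

definition standard_overlap_classes ::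
    "(int ^ 'd::finite) set \<Rightarrow> ((int ^ 'd) \<Rightarrow>\<^sub>0 'k::field) set \<Rightarrow> (int ^ 'd) set \<Rightarrow> 'd pair set set" where
  "standard_overlap_classes A I F =
     {C \<in> pairs A // overlap A. \<exists>p\<in>C. standard_pair A I p \<and> snd p = F}"

end

theory Submission
  imports Defs "HOL-Analysis.Kronecker_Approximation_Theorem"
begin

text \<open>
  Write \<open>N\<close>, \<open>NF\<close> and \<open>L\<close> for the monoid of \<open>A\<close>, the monoid of \<open>F\<close> and the group generated by \<open>F\<close>,
  and let \<open>S\<close> be the complement of the prime of \<open>F\<close>. Since \<open>S\<close> contains the monomials with
  exponents in \<open>NF\<close>, exponents matter after localization only modulo \<open>L\<close>. A class of \<open>N\<close> modulo \<open>L\<close>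
  survives in the localization modulo \<open>I\<close> exactly if no exponent in it belongs to \<open>I\<close>; in
  terms of a representative \<open>a\<close>, if \<open>a + NF\<close> consists of standard monomials. The surviving classes
  are therefore the overlap classes of the proper pairs with face \<open>F\<close>. The theorem says which of
  them contribute to the multiplicity.

  Lengths are counted without leaving the semigroup ring: ideals of the localized quotient
  correspond to the ideals that contain \<open>I\<close> and are saturated with respect to \<open>S\<close>
  (\<open>contr_ext\<close>, \<open>ext_contr\<close>). If \<open>U\<close> is a set of exponents closed under passing to a larger class in
  the divisibility order modulo \<open>L\<close>, then the span of its monomials is saturated
  (\<open>upset_saturated\<close>): look at a minimal class outside \<open>U\<close> in the support of a polynomial \<open>r\<close>; only the
  part of \<open>s \<in> S\<close> with exponents in \<open>NF\<close> contributes to that class of \<open>s r\<close>, and the prime is prime.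
  Enlarging \<open>U\<close> by one class leaves no room for a further saturated ideal in between, because up to
  a unit of the localization any two polynomials can be made to cancel in a single class
  (\<open>cancel_class\<close>). Hence the length between two such spans is the number of classes that
  separates them (\<open>rank_exists\<close>, \<open>upset_chain_exists\<close>).

  Call a surviving class torsion if it does not lie in a proper pair of a face strictly
  larger than \<open>F\<close>. If \<open>a\<close> is torsion and \<open>x\<close> is a generator outside \<open>F\<close>, then \<open>a + n x\<close> is killed for
  some \<open>n\<close>: otherwise \<open>a\<close> would give a proper pair with the smallest face containing \<open>F\<close> and \<open>x\<close>
  (\<open>torsion_escapes\<close>). Dickson's lemma then leaves only finitely many torsion classes
  (\<open>finite_classes_torsion\<close>), so the span of the torsion and killed monomials has finite length.
  It is the largest ideal of finite length: a polynomial with another monomial \<open>b\<close> in its support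
  can be multiplied by the powers of \<open>t\<^sup>x\<close> for some \<open>x \<in> G - F\<close> with \<open>b + nat_span G\<close> standard, and by
  Nakayama's lemma the ideals so obtained descend forever (\<open>unbounded_chain\<close>). The multiplicity is
  therefore the number of torsion classes.

  Finally, torsion classes are the overlap classes of standard pairs. A standard pair with face
  \<open>F\<close> is maximal, so no larger face is possible. Conversely, strong convexity gives every torsion
  class a representative from which no nonzero element of \<open>NF\<close> can be subtracted within \<open>N\<close>
  (\<open>exists_minimal_base\<close>), and that one is the base of a standard pair.
\<close>

section \<open>Integral points of cones and faces\<close>

lemma nat_spanI: "(\<Sum>b\<in>B. int (c b) *s b) \<in> nat_span B"
  unfolding nat_span_def by blast

lemma nat_span_zero [simp]: "0 \<in> nat_span B"
  using nat_spanI[of "\<lambda>_. 0" B] by simp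

lemma nat_span_add [simp]:
  assumes "x \<in> nat_span B" "y \<in> nat_span B"
  shows "x + y \<in> nat_span B"
proof -
  obtain c d where "x = (\<Sum>b\<in>B. int (c b) *s b)" "y = (\<Sum>b\<in>B. int (d b) *s b)"
    using assms unfolding nat_span_def by blast
  then have "x + y = (\<Sum>b\<in>B. int (c b + d b) *s b)"
    by (simp add: sum.distrib vector_sadd_rdistrib)
  then show ?thesis using nat_spanI by metis
qed

lemma nat_span_base:
  assumes "finite B" "b \<in> B"
  shows "b \<in> nat_span B"
proof -
  have "(\<Sum>a\<in>B. int (if a = b then 1 else 0) *s a) = (\<Sum>a\<in>B. if a = b then a else 0)"
    by (intro sum.cong) auto
  also have "\<dots> = b" using assms by simp
  finally show ?thesis using nat_spanI[of "\<lambda>a. if a = b then 1 else 0" B] by (simp only:)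
qed

lemma nat_span_scale: "x \<in> nat_span B \<Longrightarrow> int n *s x \<in> nat_span B"
  by (induction n) (auto simp: vector_sadd_rdistrib)

lemma nat_span_subset:
  assumes "finite B" "B \<subseteq> M" "0 \<in> M" "\<And>x y. x \<in> M \<Longrightarrow> y \<in> M \<Longrightarrow> x + y \<in> M"
  shows "nat_span B \<subseteq> M"
proof
  fix x assume "x \<in> nat_span B"
  then obtain c where x: "x = (\<Sum>b\<in>B. int (c b) *s b)" unfolding nat_span_def by blast
  have "int n *s b \<in> M" if "b \<in> M" for b n
    using that by (induction n) (auto simp: vector_sadd_rdistrib assms)
  then have *: "int (c b) *s b \<in> M" if "b \<in> B" for b using assms(2) that by blast
  have "(\<Sum>b\<in>C. int (c b) *s b) \<in> M" if "C \<subseteq> B" for C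
    using finite_subset[OF that assms(1)] that
    by (induction C rule: finite_induct) (auto simp: assms *)
  then show "x \<in> M" unfolding x by blast
qed

lemma nat_span_mono: "finite C \<Longrightarrow> B \<subseteq> C \<Longrightarrow> nat_span B \<subseteq> nat_span C"
  by (rule nat_span_subset) (auto intro: finite_subset nat_span_base)

lemma int_span_eq: "int_span B = {p - q |p q. p \<in> nat_span B \<and> q \<in> nat_span B}"
proof (intro equalityI subsetI)
  fix x assume "x \<in> int_span B"
  then obtain c where x: "x = (\<Sum>b\<in>B. c b *s b)" unfolding int_span_def by blast
  have "c b *s b = int (nat (c b)) *s b - int (nat (- c b)) *s b" for b
    by (cases "c b \<ge> 0") (simp_all add: vec_eq_iff)
  then have "x = (\<Sum>b\<in>B. int (nat (c b)) *s b) - (\<Sum>b\<in>B. int (nat (- c b)) *s b)"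
    unfolding x by (simp add: sum_subtractf)
  then show "x \<in> {p - q |p q. p \<in> nat_span B \<and> q \<in> nat_span B}"
    using nat_spanI[of "\<lambda>b. nat (c b)" B] nat_spanI[of "\<lambda>b. nat (- c b)" B] by blast
next
  fix x assume "x \<in> {p - q |p q. p \<in> nat_span B \<and> q \<in> nat_span B}"
  then obtain c d where "x = (\<Sum>b\<in>B. int (c b) *s b) - (\<Sum>b\<in>B. int (d b) *s b)"
    unfolding nat_span_def by blast
  then have "x = (\<Sum>b\<in>B. (int (c b) - int (d b)) *s b)"
    by (simp add: sum_subtractf vector_ssub_ldistrib vec_eq_iff algebra_simps)
  then show "x \<in> int_span B" unfolding int_span_def by (intro CollectI exI[of _ "\<lambda>b. int (c b) - int (d b)"]) simp
qed

lemma int_span_diff: "p \<in> nat_span B \<Longrightarrow> q \<in> nat_span B \<Longrightarrow> p - q \<in> int_span B"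
  by (auto simp: int_span_eq)

lemma nat_span_int_span: "p \<in> nat_span B \<Longrightarrow> p \<in> int_span B"
  using int_span_diff[of p B 0] by simp

lemma int_span_zero [simp]: "0 \<in> int_span B"
  by (rule nat_span_int_span) simp

lemma int_span_add: "x \<in> int_span B \<Longrightarrow> y \<in> int_span B \<Longrightarrow> x + y \<in> int_span B"
proof -
  assume "x \<in> int_span B" "y \<in> int_span B"
  then obtain p q r s where "x = p - q" "y = r - s"
    and *: "p \<in> nat_span B" "q \<in> nat_span B" "r \<in> nat_span B" "s \<in> nat_span B"
    unfolding int_span_eq by blast
  then have "x + y = (p + r) - (q + s)" by simp
  then show ?thesis using int_span_diff[of "p + r" B "q + s"] * by auto
qed

lemma int_span_uminus: "x \<in> int_span B \<Longrightarrow> - x \<in> int_span B"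
  by (force simp: int_span_eq)

lemma int_span_minus: "x \<in> int_span B \<Longrightarrow> y \<in> int_span B \<Longrightarrow> x - y \<in> int_span B"
  using int_span_add[of x B "- y"] int_span_uminus[of y B] by simp

text \<open>Clearing denominators: an element of the group is a difference of elements of the monoid, and
  finitely many subtrahends can be added up.\<close>

lemma finite_common_denominator:
  assumes "finite X" "X \<subseteq> int_span B"
  shows "\<exists>f\<in>nat_span B. \<forall>x\<in>X. x + f \<in> nat_span B"
  using assms
proof (induction X rule: finite_induct)
  case (insert x X)
  then obtain f where f: "f \<in> nat_span B" "\<forall>x\<in>X. x + f \<in> nat_span B" by auto
  obtain p q where pq: "p \<in> nat_span B" "q \<in> nat_span B" "x = p - q"
    using insert.prems unfolding int_span_eq by blast
  have "y + (f + q) \<in> nat_span B" if "y \<in> insert x X" for y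
  proof (cases "y = x")
    case True
    then have "y + (f + q) = p + f" using pq(3) by simp
    then show ?thesis using nat_span_add[OF pq(1) f(1)] by (simp only:)
  next
    case False
    then have "(y + f) + q \<in> nat_span B" using that f pq by auto
    then show ?thesis by (simp add: add.assoc)
  qed
  then show ?case by (intro bexI[of _ "f + q"] ballI) (use f pq in auto)
qed (auto intro: nat_span_zero)

lemma real_vec_add: "real_vec (a + b) = real_vec a + real_vec b"
  by (simp add: real_vec_def vec_eq_iff)

lemma real_vec_scale: "real_vec (k *s a) = real_of_int k *\<^sub>R real_vec a"
  by (simp add: real_vec_def vec_eq_iff)

lemma real_vec_eq_zero [simp]: "real_vec a = 0 \<longleftrightarrow> a = 0"
  by (simp add: real_vec_def vec_eq_iff)

lemma real_vec_uminus: "real_vec (- a) = - real_vec a"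
  by (simp add: real_vec_def vec_eq_iff)

lemma real_vec_sum: "real_vec (sum f B) = (\<Sum>b\<in>B. real_vec (f b))"
  by (induction B rule: infinite_finite_induct) (auto simp: real_vec_add)

lemma real_coneI: "(\<And>b. b \<in> B \<Longrightarrow> 0 \<le> c b) \<Longrightarrow> (\<Sum>b\<in>B. c b *\<^sub>R real_vec b) \<in> real_cone B"
  unfolding real_cone_def by blast

lemma real_coneE:
  assumes "x \<in> real_cone B"
  obtains c where "\<And>b. b \<in> B \<Longrightarrow> 0 \<le> c b" "x = (\<Sum>b\<in>B. c b *\<^sub>R real_vec b)"
  using assms unfolding real_cone_def by blast

lemma real_cone_scale: "x \<in> real_cone B \<Longrightarrow> 0 \<le> t \<Longrightarrow> t *\<^sub>R x \<in> real_cone B"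
  by (elim real_coneE) (auto simp: scaleR_sum_right intro!: real_coneI)

lemma real_cone_add: "x \<in> real_cone B \<Longrightarrow> y \<in> real_cone B \<Longrightarrow> x + y \<in> real_cone B"
  by (elim real_coneE) (auto simp: sum.distrib[symmetric] scaleR_left_distrib[symmetric] intro!: real_coneI)

lemma real_vec_nat_span: "x \<in> nat_span B \<Longrightarrow> real_vec x \<in> real_cone B"
  unfolding nat_span_def by (auto simp: real_vec_sum real_vec_scale intro!: real_coneI)

lemma real_cone_mono:
  assumes "finite C" "B \<subseteq> C"
  shows "real_cone B \<subseteq> real_cone C"
proof
  fix x assume "x \<in> real_cone B"
  then obtain c where c: "\<forall>b\<in>B. 0 \<le> c b" "x = (\<Sum>b\<in>B. c b *\<^sub>R real_vec b)"
    unfolding real_cone_def by blast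
  have "x = (\<Sum>b\<in>C. (if b \<in> B then c b else 0) *\<^sub>R real_vec b)"
    unfolding c(2) using assms by (intro sum.mono_neutral_cong_left) auto
  then show "x \<in> real_cone C" using c(1) by (auto intro!: real_coneI)
qed

lemma convex_real_cone: "convex (real_cone B)"
  by (intro convexI real_cone_add real_cone_scale)

text \<open>Real relations between integer vectors can be made integral without changing the signs of the
  coefficients. Simultaneous Dirichlet approximation gives a scaling \<open>q \<ge> 1\<close> and integers \<open>p j\<close>
  with \<open>q * x j - p j\<close> smaller than \<open>1 / N\<close>. The combination with coefficients \<open>p j\<close> has integer
  coordinates, and they are less than \<open>1\<close> in absolute value, so it vanishes.\<close>

lemma integer_relation:
  fixes u :: "'j \<Rightarrow> int ^ 'd::finite" and x :: "'j \<Rightarrow> real"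
  assumes "finite J" and rel: "(\<Sum>j\<in>J. x j *\<^sub>R real_vec (u j)) = 0"
  shows "\<exists>p::'j \<Rightarrow> int. (\<Sum>j\<in>J. p j *s u j) = 0 \<and>
    (\<forall>j\<in>J. 0 \<le> x j \<longrightarrow> 0 \<le> p j) \<and> (\<forall>j\<in>J. 0 < x j \<longrightarrow> 0 < p j)"
proof -
  \<comment> \<open>Beating \<open>c\<close> makes the coordinates of the integral combination small; beating \<open>m\<close> keeps positive
    coefficients positive.\<close>
  define c where "c = (\<Sum>j\<in>J. \<Sum>i\<in>UNIV. real_of_int \<bar>u j $ i\<bar>)"
  define m where "m = (\<Sum>j\<in>J. if 0 < x j then 1 / x j else 0)"
  obtain N :: nat where N: "c + m + 1 < real N" using reals_Archimedean2 by blast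
  have "0 \<le> c" "0 \<le> m" unfolding c_def m_def by (auto intro!: sum_nonneg)
  then have N0: "N > 0" "c < real N" "m < real N" using N by (auto intro: gr0I)
  obtain h where h: "bij_betw h {..<card J} J"
    using ex_bij_betw_nat_finite[OF assms(1)] by (auto simp: atLeast0LessThan)
  obtain q p' where q: "0 < q" and p': "\<And>i. i < card J \<Longrightarrow> \<bar>of_int q * x (h i) - of_int (p' i)\<bar> < 1 / N"
    using Dirichlet_approx_simult[OF N0(1), of "card J" "\<lambda>i. x (h i)"] by metis
  define p where "p j = p' (the_inv_into {..<card J} h j)" for j
  have p: "\<bar>of_int q * x j - of_int (p j)\<bar> < 1 / N" if "j \<in> J" for j
  proof -
    obtain i where "i < card J" "j = h i" using h \<open>j \<in> J\<close> by (auto simp: bij_betw_def)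
    then show ?thesis using p'[of i] h by (simp add: p_def bij_betw_def the_inv_into_f_f)
  qed
  have "(\<Sum>j\<in>J. p j *s u j) $ i = 0" for i
  proof -
    have "(\<Sum>j\<in>J. x j * real_of_int (u j $ i)) = 0"
      using arg_cong[OF rel, of "\<lambda>v. v $ i"] by (simp add: real_vec_def)
    then have z: "(\<Sum>j\<in>J. (q * x j) * real_of_int (u j $ i)) = 0"
      by (simp add: mult.assoc sum_distrib_left[symmetric])
    have "real_of_int ((\<Sum>j\<in>J. p j *s u j) $ i) = (\<Sum>j\<in>J. (p j - q * x j) * real_of_int (u j $ i))"
      using z by (simp add: left_diff_distrib sum_subtractf)
    also have "\<bar>\<dots>\<bar> \<le> (\<Sum>j\<in>J. 1 / N * real_of_int \<bar>u j $ i\<bar>)"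
      unfolding of_int_abs
      by (rule order.trans[OF sum_abs], unfold abs_mult, intro sum_mono mult_right_mono)
         (use p in \<open>auto simp: abs_minus_commute intro: less_imp_le\<close>)
    also have "\<dots> \<le> 1 / N * c"
      unfolding c_def sum_distrib_left[symmetric]
      by (intro mult_left_mono sum_mono member_le_sum) auto
    also have "\<dots> < 1" using N0 by simp
    finally show ?thesis by linarith
  qed
  then have "(\<Sum>j\<in>J. p j *s u j) = 0" by (simp add: vec_eq_iff)
  moreover have "0 \<le> p j" if "j \<in> J" "0 \<le> x j" for j
  proof -
    have "0 \<le> of_int q * x j" using q that by simp
    moreover have "1 / real N \<le> 1" using N0 by simp
    ultimately have "- 1 < real_of_int (p j)" using p[OF that(1)] by linarith
    then show ?thesis by linarith
  qed
  moreover have "0 < p j" if "j \<in> J" "0 < x j" for j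
  proof -
    have "1 / x j \<le> m" unfolding m_def using that assms(1)
      by (intro order.trans[OF _ member_le_sum[of j]]) auto
    then have "1 / x j < N" using N0 by simp
    then have "1 / N < x j" using that N0 by (simp add: field_simps)
    moreover have "1 * x j \<le> of_int q * x j" using q that by (intro mult_right_mono) auto
    ultimately have "0 < real_of_int (p j)" using p[OF that(1)] by linarith
    then show ?thesis by simp
  qed
  ultimately show ?thesis by (intro exI[of _ p]) simp
qed

text \<open>A generator that occurs with positive coefficient in a real combination lying in the cone of
  \<open>G\<close> already divides an element of the monoid of \<open>G\<close>. This is how real faces are compared with
  monoids.\<close>

lemma cone_summand:
  assumes fin: "finite A" "finite G" and c: "\<And>a. a \<in> A \<Longrightarrow> 0 \<le> c a"
    and mem: "(\<Sum>a\<in>A. c a *\<^sub>R real_vec a) \<in> real_cone G" and a: "a \<in> A" "0 < c a"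
  shows "\<exists>h\<in>nat_span A. a + h \<in> nat_span G"
proof -
  obtain t where t: "\<forall>g\<in>G. 0 \<le> t g"
      "(\<Sum>a\<in>A. c a *\<^sub>R real_vec a) = (\<Sum>g\<in>G. t g *\<^sub>R real_vec g)"
    using mem unfolding real_cone_def by blast
  have "(\<Sum>j\<in>A <+> G. case_sum c t j *\<^sub>R real_vec (case_sum id uminus j)) = 0"
    using fin t(2) by (simp add: sum.Plus real_vec_uminus sum_negf)
  then have "\<exists>p. (\<Sum>j\<in>A <+> G. p j *s case_sum id uminus j) = 0 \<and>
      (\<forall>j\<in>A <+> G. 0 \<le> case_sum c t j \<longrightarrow> 0 \<le> p j) \<and> (\<forall>j\<in>A <+> G. 0 < case_sum c t j \<longrightarrow> 0 < p j)"
    by (rule integer_relation[OF finite_Plus[OF fin]])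
  then obtain p where p: "(\<Sum>j\<in>A <+> G. p j *s case_sum id uminus j) = 0"
    "\<forall>j\<in>A <+> G. 0 \<le> case_sum c t j \<longrightarrow> 0 \<le> p j"
    "\<forall>j\<in>A <+> G. 0 < case_sum c t j \<longrightarrow> 0 < p j"
    by (elim exE conjE)
  define m where "m b = nat (p (Inl b))" for b
  define n where "n b = nat (p (Inr b))" for b
  have mn: "p (Inl b) = int (m b)" if "b \<in> A" for b using p(2)[rule_format, of "Inl b"] that c by (auto simp: m_def)
  have nn: "p (Inr b) = int (n b)" if "b \<in> G" for b using p(2)[rule_format, of "Inr b"] that t(1) by (auto simp: n_def)
  have mg: "(\<Sum>b\<in>A. int (m b) *s b) = (\<Sum>g\<in>G. int (n g) *s g)"
    using p(1) fin mn nn by (simp add: sum.Plus sum_negf vec_eq_iff)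
  have "m a > 0" using p(3)[rule_format, of "Inl a"] a by (auto simp: m_def)
  have "(\<Sum>b\<in>A. int (m b) *s b) = (\<Sum>b\<in>A. (if b = a then a else 0) + int (m b - (if b = a then 1 else 0)) *s b)"
  proof (intro sum.cong refl)
    fix b
    obtain k where "m a = Suc k" using \<open>m a > 0\<close> gr0_implies_Suc by blast
    then show "int (m b) *s b = (if b = a then a else 0) + int (m b - (if b = a then 1 else 0)) *s b"
      by (auto simp: vector_sadd_rdistrib)
  qed
  also have "\<dots> = a + (\<Sum>b\<in>A. int (m b - (if b = a then 1 else 0)) *s b)"
    using a fin by (simp add: sum.distrib)
  finally have "(\<Sum>b\<in>A. int (m b) *s b) = a + (\<Sum>b\<in>A. int (m b - (if b = a then 1 else 0)) *s b)" .
  then have "a + (\<Sum>b\<in>A. int (m b - (if b = a then 1 else 0)) *s b) \<in> nat_span G"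
    using mg nat_spanI[of n G] by simp
  then show ?thesis by (intro bexI[OF _ nat_spanI])
qed

text \<open>The vector \<open>(a + h) / 2\<close> lies in the cone of \<open>F\<close> and halfway between \<open>a\<close> and \<open>h\<close>, which is where
  the definition of a face of a convex set applies.\<close>

lemma face_base:
  assumes "finite A" "is_face A F" "a \<in> A" "h \<in> nat_span A" "a + h \<in> nat_span F"
  shows "a \<in> F"
proof -
  let ?v = "(1/2) *\<^sub>R real_vec (a + h)"
  have F: "real_cone F face_of real_cone A" "{a \<in> A. real_vec a \<in> real_cone F} = F"
    using assms(2) by (auto simp: is_face_def)
  have v: "?v \<in> real_cone F" using assms by (intro real_cone_scale real_vec_nat_span) auto
  have av: "real_vec a \<in> real_cone A" "real_vec h \<in> real_cone A"
    using assms by (auto intro!: real_vec_nat_span nat_span_base)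
  have "real_vec a \<in> real_cone F"
  proof (cases "real_vec a = real_vec h")
    case True
    then have "?v = real_vec a" by (simp add: real_vec_add scaleR_2[symmetric])
    then show ?thesis using v by simp
  next
    case False
    have "?v = midpoint (real_vec a) (real_vec h)" by (simp add: midpoint_def real_vec_add)
    then have "?v \<in> open_segment (real_vec a) (real_vec h)" using False midpoint_in_open_segment by metis
    then show ?thesis using face_ofD[OF F(1)] av v by blast
  qed
  then show ?thesis using F(2) assms(3) by blast
qed

text \<open>The monoid of a face is closed under taking summands, since by \<open>face_base\<close> it contains every
  generator that occurs in one of its elements.\<close>

lemma face_nat_span:
  assumes "finite A" "is_face A F" "x \<in> nat_span A" "y \<in> nat_span A" "x + y \<in> nat_span F"
  shows "x \<in> nat_span F"
proof -
  have F: "finite F" "F \<subseteq> A" using assms finite_subset by (auto simp: is_face_def)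
  have "nat_span A \<subseteq> {x \<in> nat_span A. \<forall>y\<in>nat_span A. x + y \<in> nat_span F \<longrightarrow> x \<in> nat_span F}"
  proof (rule nat_span_subset)
    show "A \<subseteq> {x \<in> nat_span A. \<forall>y\<in>nat_span A. x + y \<in> nat_span F \<longrightarrow> x \<in> nat_span F}"
      using assms(1,2) face_base F by (auto intro!: nat_span_base)
  next
    fix x y assume x: "x \<in> {x \<in> nat_span A. \<forall>y\<in>nat_span A. x + y \<in> nat_span F \<longrightarrow> x \<in> nat_span F}"
      and y: "y \<in> {x \<in> nat_span A. \<forall>y\<in>nat_span A. x + y \<in> nat_span F \<longrightarrow> x \<in> nat_span F}"
    have "x + y \<in> nat_span F" if "z \<in> nat_span A" "x + y + z \<in> nat_span F" for z
    proof -
      have "x + (y + z) \<in> nat_span F" "y + (x + z) \<in> nat_span F" using that by (simp_all add: ac_simps)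
      moreover have "y + z \<in> nat_span A" "x + z \<in> nat_span A" using x y that by auto
      ultimately have "x \<in> nat_span F" "y \<in> nat_span F" using x y by (auto simp del: nat_span_add)
      then show ?thesis by simp
    qed
    then show "x + y \<in> {x \<in> nat_span A. \<forall>y\<in>nat_span A. x + y \<in> nat_span F \<longrightarrow> x \<in> nat_span F}"
      using x y by (intro CollectI conjI ballI impI) auto
  qed (use assms in auto)
  then show ?thesis using assms by blast
qed

text \<open>The divisors \<open>D\<close> of a submonoid \<open>W\<close> are cut out by a face. For \<open>W\<close> generated by \<open>F\<close> and one
  further generator this produces the smallest face containing both, in a form in which
  membership of \<open>g\<close> means divisibility by \<open>g\<close> rather than a real inequality.\<close>

lemma face_generated:
  assumes A: "finite A" and W: "W \<subseteq> nat_span A" "0 \<in> W" "\<And>v w. v \<in> W \<Longrightarrow> w \<in> W \<Longrightarrow> v + w \<in> W"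
  defines "D \<equiv> {y \<in> nat_span A. \<exists>h\<in>nat_span A. y + h \<in> W}"
  shows "is_face A (D \<inter> A)" "nat_span (D \<inter> A) \<subseteq> D"
proof -
  have D_add: "x + y \<in> D" if "x \<in> D" "y \<in> D" for x y
  proof -
    obtain h k where hk: "h \<in> nat_span A" "k \<in> nat_span A" "x + h \<in> W" "y + k \<in> W"
      using \<open>x \<in> D\<close> \<open>y \<in> D\<close> by (auto simp: D_def)
    then have "(x + y) + (h + k) \<in> W" using W(3)[OF hk(3,4)] by (simp add: ac_simps)
    then show ?thesis using that hk by (auto simp: D_def)
  qed
  have "0 \<in> D" using W by (auto simp: D_def)
  with D_add show D: "nat_span (D \<inter> A) \<subseteq> D" using A by (intro nat_span_subset) auto
  let ?G = "D \<inter> A"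
  have G: "finite ?G" using A by simp
  have *: "a \<in> ?G" if pos: "\<And>a. a \<in> A \<Longrightarrow> 0 \<le> c a" and mem: "(\<Sum>a\<in>A. c a *\<^sub>R real_vec a) \<in> real_cone ?G" and "a \<in> A" "0 < c a" for a c
  proof -
    obtain h where h: "h \<in> nat_span A" "a + h \<in> nat_span ?G"
      using cone_summand[OF A G pos mem \<open>a \<in> A\<close> \<open>0 < c a\<close>] by blast
    then have "a + h \<in> D" using D by blast
    then obtain k where "k \<in> nat_span A" "a + h + k \<in> W" by (auto simp: D_def)
    then have "a + (h + k) \<in> W" "h + k \<in> nat_span A" using h by (auto simp: add.assoc)
    then show ?thesis using that A by (auto simp: D_def intro!: nat_span_base)
  qed
  \<comment> \<open>One end of a segment meeting the cone of \<open>D \<inter> A\<close> in its interior; both ends follow by symmetry.\<close>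
  have half: "x \<in> real_cone ?G" if "x \<in> real_cone A" "y \<in> real_cone A" "0 < u" "u \<le> 1"
    "u *\<^sub>R x + (1 - u) *\<^sub>R y \<in> real_cone ?G" for x y u
  proof -
    obtain c where c: "\<forall>a\<in>A. 0 \<le> c a" "x = (\<Sum>a\<in>A. c a *\<^sub>R real_vec a)"
      using \<open>x \<in> real_cone A\<close> unfolding real_cone_def by blast
    obtain d where d: "\<forall>a\<in>A. 0 \<le> d a" "y = (\<Sum>a\<in>A. d a *\<^sub>R real_vec a)"
      using \<open>y \<in> real_cone A\<close> unfolding real_cone_def by blast
    have "u *\<^sub>R x + (1 - u) *\<^sub>R y = (\<Sum>a\<in>A. (u * c a + (1 - u) * d a) *\<^sub>R real_vec a)"
      unfolding c d by (simp add: scaleR_sum_right sum.distrib[symmetric] scaleR_left_distrib)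
    with \<open>u *\<^sub>R x + (1 - u) *\<^sub>R y \<in> real_cone ?G\<close>
    have xy: "(\<Sum>a\<in>A. (u * c a + (1 - u) * d a) *\<^sub>R real_vec a) \<in> real_cone ?G" by simp
    have "a \<in> ?G" if "a \<in> A" "c a \<noteq> 0" for a
    proof (rule *[OF _ xy \<open>a \<in> A\<close>])
      have "0 < c a" using c(1) that by (simp add: less_le)
      then show "0 < u * c a + (1 - u) * d a"
        using d(1) \<open>a \<in> A\<close> \<open>0 < u\<close> \<open>u \<le> 1\<close> by (intro add_pos_nonneg) auto
    qed (use c(1) d(1) \<open>0 < u\<close> \<open>u \<le> 1\<close> in auto)
    then have "x = (\<Sum>a\<in>?G. c a *\<^sub>R real_vec a)" unfolding c using A
      by (intro sum.mono_neutral_right) auto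
    then show ?thesis using c(1) by (auto intro!: real_coneI)
  qed
  have "real_cone ?G face_of real_cone A"
    unfolding face_of_def
  proof (intro conjI ballI impI)
    fix x y z assume xyz: "x \<in> real_cone A" "y \<in> real_cone A" "z \<in> real_cone ?G" "z \<in> open_segment x y"
    then obtain u where u: "0 < u" "u < 1" "z = (1 - u) *\<^sub>R x + u *\<^sub>R y" by (auto simp: in_segment)
    show "x \<in> real_cone ?G" using half[of x y "1 - u"] xyz u by simp
    show "y \<in> real_cone ?G" using half[of y x u] xyz u by (simp add: add.commute)
  qed (use A real_cone_mono[of A ?G] convex_real_cone in auto)
  moreover have "a \<in> ?G" if "a \<in> A" "real_vec a \<in> real_cone ?G" for a
  proof -
    have "(\<Sum>b\<in>A. (if b = a then 1 else 0) *\<^sub>R real_vec b) = (\<Sum>b\<in>A. if b = a then real_vec b else 0)"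
      by (intro sum.cong) auto
    also have "\<dots> = real_vec a" using A that by simp
    finally show ?thesis using *[of "\<lambda>b. if b = a then 1 else 0" a] that by simp
  qed
  moreover have "real_vec a \<in> real_cone ?G" if "a \<in> ?G" for a
    using that G by (intro real_vec_nat_span nat_span_base)
  ultimately show "is_face A ?G" unfolding is_face_def by blast
qed

section \<open>Finiteness from the well-quasi-order on vectors of natural numbers\<close>

text \<open>A monotone subsequence exists; if it is decreasing, it becomes constant once it has reached its
  least value.\<close>

lemma nat_seq_incseq:
  fixes u :: "nat \<Rightarrow> nat"
  shows "\<exists>f. strict_mono f \<and> incseq (\<lambda>n. u (f n))"
proof -
  obtain f where f: "strict_mono f" "monoseq (\<lambda>n. u (f n))"
    using seq_monosub[of u] by blast
  show ?thesis
  proof (cases "incseq (\<lambda>n. u (f n))")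
    case False
    then have dec: "decseq (\<lambda>n. u (f n))" using f(2) by (auto simp: monoseq_iff)
    obtain N where N: "\<And>n. u (f N) \<le> u (f n)"
      using ex_has_least_nat[of "\<lambda>_. True" _ "\<lambda>n. u (f n)"] by blast
    have "u (f (n + N)) = u (f N)" for n
      using N[of "n + N"] decseqD[OF dec, of N "n + N"] by simp
    then have "incseq (\<lambda>n. u (f (n + N)))" by simp
    moreover have "strict_mono (\<lambda>n. f (n + N))" using f(1) by (simp add: strict_mono_def)
    ultimately show ?thesis by blast
  qed (use f in blast)
qed

lemma coordinatewise_incseq:
  fixes v :: "nat \<Rightarrow> 'a \<Rightarrow> nat"
  assumes "finite X"
  shows "\<exists>f. strict_mono f \<and> (\<forall>x\<in>X. incseq (\<lambda>n. v (f n) x))"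
  using assms
proof (induction X rule: finite_induct)
  case empty
  show ?case using strict_mono_id by blast
next
  case (insert x X)
  then obtain f where f: "strict_mono f" "\<forall>x\<in>X. incseq (\<lambda>n. v (f n) x)" by blast
  obtain g where g: "strict_mono g" "incseq (\<lambda>n. v (f (g n)) x)"
    using nat_seq_incseq[of "\<lambda>n. v (f n) x"] by blast
  have "incseq (\<lambda>n. v (f (g n)) y)" if "y \<in> X" for y
    using f(2) that g(1) unfolding incseq_def by (metis strict_mono_leD)
  then show ?case using f g strict_mono_o[OF f(1) g(1)]
    by (intro exI[of _ "\<lambda>n. f (g n)"]) (auto simp: o_def)
qed

text \<open>Dickson's lemma in the form used below. An injective sequence in \<open>V\<close> has a subsequence that
  increases in every coordinate; if all coordinates were bounded along it, it would take only
  finitely many values.\<close>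

lemma infinite_increasing_coordinate:
  fixes V :: "('a \<Rightarrow> nat) set"
  assumes "finite X" "infinite V" and zero: "\<And>v x. v \<in> V \<Longrightarrow> x \<notin> X \<Longrightarrow> v x = 0"
  shows "\<exists>v\<in>V. \<exists>x\<in>X. \<forall>m. \<exists>w\<in>V. v \<le> w \<and> v x + m \<le> w x"
proof -
  obtain s :: "nat \<Rightarrow> _" where s: "inj s" "range s \<subseteq> V" using infinite_countable_subset[OF assms(2)] by blast
  obtain f where f: "strict_mono f" "\<forall>x\<in>X. incseq (\<lambda>n. s (f n) x)"
    using coordinatewise_incseq[OF assms(1)] by blast
  define t where "t n = s (f n)" for n
  have t: "t n \<in> V" for n using s by (auto simp: t_def)
  have inj: "inj t" using inj_compose[OF s(1) strict_mono_imp_inj_on[OF f(1)]] by (simp add: t_def inj_def)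
  have le: "t 0 \<le> t n" for n
  proof (intro le_funI)
    fix x show "t 0 x \<le> t n x"
      using zero[OF t, of x] f(2) incseqD[of "\<lambda>n. s (f n) x" 0 n] by (cases "x \<in> X") (auto simp: t_def)
  qed
  have "\<exists>x\<in>X. \<forall>m. \<exists>n. t 0 x + m \<le> t n x"
  proof (rule ccontr)
    assume "\<not> ?thesis"
    then have "\<forall>x\<in>X. \<exists>m. \<forall>n. t n x < t 0 x + m" by (simp add: not_le)
    then obtain m where m: "\<And>x n. x \<in> X \<Longrightarrow> t n x < t 0 x + m x" by metis
    define M where "M = (\<Sum>x\<in>X. t 0 x + m x)"
    have "t n x \<le> M" if "x \<in> X" for x n
    proof -
      have "t 0 x + m x \<le> M" unfolding M_def using that assms(1) by (intro member_le_sum) auto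
      then show ?thesis using m[OF that, of n] by linarith
    qed
    then have "range t \<subseteq> {v. \<forall>x. (x \<in> X \<longrightarrow> v x \<in> {..M}) \<and> (x \<notin> X \<longrightarrow> v x = 0)}"
      using zero[OF t] by auto
    moreover have "finite \<dots>" using assms(1) by (intro finite_set_of_finite_funs) auto
    ultimately show False using inj finite_subset finite_imageD by blast
  qed
  then show ?thesis using t le by blast
qed

text \<open>If \<open>x\<close> had a positive coefficient, dividing by it would express \<open>- x\<close> as an element of the
  cone, which then contains the line through \<open>x\<close>.\<close>

lemma pointed_relation:
  assumes "finite A" "0 \<notin> A" "contains_no_line (real_cone A)"
    and rel: "(\<Sum>a\<in>A. int (c a) *s a) = 0" and x: "x \<in> A"
  shows "c x = 0"
proof (rule ccontr)
  assume c: "c x \<noteq> 0"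
  have "(\<Sum>a\<in>A. int (c a) *s a) = int (c x) *s x + (\<Sum>a\<in>A - {x}. int (c a) *s a)"
    using assms(1) x by (rule sum.remove)
  then have "- (int (c x) *s x) = (\<Sum>a\<in>A - {x}. int (c a) *s a)"
    using rel by (simp add: minus_unique)
  moreover have "\<dots> \<in> nat_span A"
    using nat_spanI nat_span_mono[of A "A - {x}"] assms(1) by blast
  ultimately have "real_vec (- (int (c x) *s x)) \<in> real_cone A" using real_vec_nat_span by metis
  then have "(1 / c x) *\<^sub>R real_vec (- (int (c x) *s x)) \<in> real_cone A" by (intro real_cone_scale) auto
  then have neg: "- real_vec x \<in> real_cone A" using c by (simp add: real_vec_uminus real_vec_scale)
  have pos: "real_vec x \<in> real_cone A" using x assms by (intro real_vec_nat_span nat_span_base)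
  have "0 + t *\<^sub>R real_vec x \<in> real_cone A" for t
    using real_cone_scale[OF pos, of t] real_cone_scale[OF neg, of "- t"] by (cases "0 \<le> t") auto
  moreover have "real_vec x \<noteq> 0" using x assms by auto
  ultimately show False using assms(3) unfolding contains_no_line_def by blast
qed

text \<open>Among infinitely many representations of \<open>b\<close> there would be two comparable ones, whose difference
  is a relation excluded by \<open>pointed_relation\<close>.\<close>

lemma finite_representations:
  assumes "finite A" "0 \<notin> A" "contains_no_line (real_cone A)"
  shows "finite {v. (\<forall>a. a \<notin> A \<longrightarrow> v a = 0) \<and> (\<Sum>a\<in>A. int (v a) *s a) = b}" (is "finite ?V")
proof (rule ccontr)
  assume "infinite ?V"
  then obtain v x w where vw: "v \<in> ?V" "x \<in> A" "w \<in> ?V" "v \<le> w" "v x + 1 \<le> w x"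
    using infinite_increasing_coordinate[OF assms(1), of ?V] by (smt (verit) mem_Collect_eq)
  have "(\<Sum>a\<in>A. int (w a - v a) *s a) = (\<Sum>a\<in>A. int (w a) *s a) - (\<Sum>a\<in>A. int (v a) *s a)"
    using vw(4) by (simp add: le_fun_def of_nat_diff sum_subtractf[symmetric] vec_eq_iff left_diff_distrib)
  also have "\<dots> = 0" using vw by simp
  finally have "w x - v x = 0" using pointed_relation[OF assms, of "\<lambda>a. w a - v a"] vw(2) by blast
  then show False using vw(5) by simp
qed

lemma nat_span_supported:
  assumes "x \<in> nat_span F" "F \<subseteq> A" "finite A"
  shows "\<exists>v. (\<forall>a. a \<notin> F \<longrightarrow> v a = 0) \<and> x = (\<Sum>a\<in>A. int (v a) *s a)"
proof -
  obtain c where c: "x = (\<Sum>a\<in>F. int (c a) *s a)" using assms unfolding nat_span_def by blast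
  have "x = (\<Sum>a\<in>A. int (if a \<in> F then c a else 0) *s a)"
    unfolding c using assms by (intro sum.mono_neutral_cong_left) auto
  then show ?thesis by (intro exI[of _ "\<lambda>a. if a \<in> F then c a else 0"]) auto
qed

text \<open>Elements of \<open>F\<close> can be subtracted from \<open>a\<close> only finitely often, because the total number of
  generators in a representation of \<open>a\<close> is bounded.\<close>

lemma exists_minimal_base:
  assumes A: "finite A" "0 \<notin> A" "contains_no_line (real_cone A)" and F: "F \<subseteq> A" and a: "a \<in> nat_span A"
  shows "\<exists>b\<in>nat_span A. a - b \<in> nat_span F \<and> (\<forall>c\<in>nat_span A. b - c \<in> nat_span F \<longrightarrow> c = b)"
proof -
  define V where "V = {v. (\<forall>x. x \<notin> F \<longrightarrow> v x = 0) \<and> a - (\<Sum>x\<in>A. int (v x) *s x) \<in> nat_span A}"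
  define U where "U = {v. (\<forall>x. x \<notin> A \<longrightarrow> v x = 0) \<and> (\<Sum>x\<in>A. int (v x) *s x) = a}"
  have U: "finite U" unfolding U_def by (rule finite_representations[OF A])
  have bound: "sum v A \<le> Max ((\<lambda>v. sum v A) ` U)" if "v \<in> V" for v
  proof -
    obtain w where w: "\<forall>x. x \<notin> A \<longrightarrow> w x = 0" "a - (\<Sum>x\<in>A. int (v x) *s x) = (\<Sum>x\<in>A. int (w x) *s x)"
      using \<open>v \<in> V\<close> nat_span_supported[OF _ subset_refl A(1)] unfolding V_def by blast
    have "(\<Sum>x\<in>A. int (v x + w x) *s x) = a"
      using w(2) by (simp add: sum.distrib vector_sadd_rdistrib algebra_simps)
    then have "(\<lambda>x. v x + w x) \<in> U" using that w F by (auto simp: U_def V_def)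
    then have "(\<Sum>x\<in>A. v x + w x) \<le> Max ((\<lambda>v. sum v A) ` U)" using U by (intro Max_ge) auto
    then show ?thesis by (simp add: sum.distrib)
  qed
  have "(\<lambda>_. 0) \<in> V" using a by (simp add: V_def)
  then obtain v where v: "v \<in> V" "\<And>w. w \<in> V \<Longrightarrow> sum w A \<le> sum v A"
    using ex_has_greatest_nat[of "\<lambda>v. v \<in> V" "\<lambda>_. 0" "\<lambda>v. sum v A" "Suc (Max ((\<lambda>v. sum v A) ` U))"] bound
    by (auto simp: less_Suc_eq_le)
  define b where "b = a - (\<Sum>x\<in>A. int (v x) *s x)"
  have b: "b \<in> nat_span A" using v by (simp add: b_def V_def)
  have "(\<Sum>x\<in>A. int (v x) *s x) = (\<Sum>x\<in>F. int (v x) *s x)"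
    using v(1) A F by (intro sum.mono_neutral_right) (auto simp: V_def)
  then have ab: "a - b \<in> nat_span F" using nat_spanI[of v F] by (simp add: b_def)
  have "c = b" if c: "c \<in> nat_span A" "b - c \<in> nat_span F" for c
  proof -
    obtain w where w: "\<forall>x. x \<notin> F \<longrightarrow> w x = 0" "b - c = (\<Sum>x\<in>A. int (w x) *s x)"
      using nat_span_supported[OF c(2) F A(1)] by blast
    have "a - (\<Sum>x\<in>A. int (v x + w x) *s x) = c"
      using w(2) by (simp add: sum.distrib vector_sadd_rdistrib algebra_simps b_def)
    then have "(\<lambda>x. v x + w x) \<in> V" using v(1) w c by (auto simp: V_def)
    from v(2)[OF this] have "\<forall>x\<in>A. w x = 0" using A(1) by (simp add: sum.distrib)
    then show ?thesis using w(2) by simp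
  qed
  then show ?thesis using b ab by blast
qed

section \<open>Rings of fractions\<close>

locale multiplicative_subset = cring R for R (structure) +
  fixes S
  assumes S_carrier: "S \<subseteq> carrier R"
    and S_one: "\<one> \<in> S"
    and S_mult: "s \<in> S \<Longrightarrow> t \<in> S \<Longrightarrow> s \<otimes> t \<in> S"
begin

lemma S_closed [simp, intro]: "s \<in> S \<Longrightarrow> s \<in> carrier R"
  using S_carrier by blast

lemma minus_eq_zero_iff: "x \<in> carrier R \<Longrightarrow> y \<in> carrier R \<Longrightarrow> x \<ominus> y = \<zero> \<longleftrightarrow> x = y"
  by (metis a_inv_closed minus_eq minus_equality minus_minus r_neg)

text \<open>Without the subtraction, equality of fractions can be checked with the laws of the
  multiplicative monoid alone.\<close>

lemma frac_rel_iff: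
  "((r, s), (r', s')) \<in> frac_rel R S \<longleftrightarrow>
    r \<in> carrier R \<and> s \<in> S \<and> r' \<in> carrier R \<and> s' \<in> S \<and>
    (\<exists>u\<in>S. u \<otimes> (s' \<otimes> r) = u \<otimes> (s \<otimes> r'))"
proof -
  have "u \<otimes> (s' \<otimes> r \<ominus> s \<otimes> r') = \<zero> \<longleftrightarrow> u \<otimes> (s' \<otimes> r) = u \<otimes> (s \<otimes> r')"
    if "r \<in> carrier R" "s \<in> S" "r' \<in> carrier R" "s' \<in> S" "u \<in> S" for u
  proof -
    have "u \<otimes> (s' \<otimes> r \<ominus> s \<otimes> r') = u \<otimes> (s' \<otimes> r) \<ominus> u \<otimes> (s \<otimes> r')"
      using that by (simp add: a_minus_def r_distr r_minus)
    then show ?thesis using that by (simp add: minus_eq_zero_iff)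
  qed
  then show ?thesis unfolding frac_rel_def by blast
qed

lemma equiv_frac_rel: "equiv (carrier R \<times> S) (frac_rel R S)"
proof (rule equivI)
  show "frac_rel R S \<subseteq> (carrier R \<times> S) \<times> (carrier R \<times> S)"
    by (auto simp: frac_rel_def)
  show "refl_on (carrier R \<times> S) (frac_rel R S)"
    using S_one by (auto simp: refl_on_def frac_rel_iff)
  show "sym (frac_rel R S)"
    unfolding sym_def by (auto simp: frac_rel_iff) metis
  show "trans (frac_rel R S)"
    unfolding trans_def
  proof (clarsimp simp: frac_rel_iff)
    fix r s r' s' r'' s'' u v
    assume *: "r \<in> carrier R" "r' \<in> carrier R" "r'' \<in> carrier R"
      "s \<in> S" "s' \<in> S" "s'' \<in> S" "u \<in> S" "v \<in> S"
      and u: "u \<otimes> (s' \<otimes> r) = u \<otimes> (s \<otimes> r')" and v: "v \<otimes> (s'' \<otimes> r') = v \<otimes> (s' \<otimes> r'')"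
    have "(u \<otimes> v \<otimes> s') \<otimes> (s'' \<otimes> r) = (v \<otimes> s'') \<otimes> (u \<otimes> (s' \<otimes> r))"
      using * by (simp add: m_ac)
    also have "\<dots> = (u \<otimes> s) \<otimes> (v \<otimes> (s'' \<otimes> r'))"
      unfolding u using * by (simp add: m_ac)
    also have "\<dots> = (u \<otimes> v \<otimes> s') \<otimes> (s \<otimes> r'')"
      unfolding v using * by (simp add: m_ac)
    finally show "\<exists>u\<in>S. u \<otimes> (s'' \<otimes> r) = u \<otimes> (s \<otimes> r'')"
      using * S_mult by blast
  qed
qed

lemma fraction_eq_iff:
  assumes "r \<in> carrier R" "s \<in> S" "r' \<in> carrier R" "s' \<in> S"
  shows "fraction R S r s = fraction R S r' s' \<longleftrightarrow> (\<exists>u\<in>S. u \<otimes> (s' \<otimes> r) = u \<otimes> (s \<otimes> r'))"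
  unfolding fraction_def using assms
  by (subst eq_equiv_class_iff[OF equiv_frac_rel]) (auto simp: frac_rel_iff)

lemma fraction_eqI:
  assumes "r \<in> carrier R" "s \<in> S" "r' \<in> carrier R" "s' \<in> S" "s' \<otimes> r = s \<otimes> r'"
  shows "fraction R S r s = fraction R S r' s'"
  using assms S_one by (auto simp: fraction_eq_iff)

lemma mem_fraction:
  assumes "r \<in> carrier R" "s \<in> S"
  shows "x \<in> fraction R S r s \<longleftrightarrow>
    fst x \<in> carrier R \<and> snd x \<in> S \<and> fraction R S (fst x) (snd x) = fraction R S r s"
proof -
  have "x \<in> fraction R S r s \<longleftrightarrow> ((r, s), x) \<in> frac_rel R S"
    by (auto simp: fraction_def)
  moreover have "((r, s), x) \<in> frac_rel R S \<longleftrightarrow>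
     fst x \<in> carrier R \<and> snd x \<in> S \<and> fraction R S (fst x) (snd x) = fraction R S r s"
    using assms equiv_class_eq_iff[OF equiv_frac_rel, of "(r, s)" x]
    unfolding fraction_def mem_Times_iff by (metis fst_conv prod.collapse snd_conv)
  ultimately show ?thesis by simp
qed

text \<open>Sums and products of fractions are defined as unions over all representatives. Such a union
  collapses to the value at given representatives if it does not depend on them.\<close>

lemma Un_fractions:
  assumes "r \<in> carrier R" "s \<in> S" "r' \<in> carrier R" "s' \<in> S"
    and g: "\<And>p q p' q'. p \<in> carrier R \<Longrightarrow> q \<in> S \<Longrightarrow> p' \<in> carrier R \<Longrightarrow> q' \<in> S \<Longrightarrow>
      fraction R S p q = fraction R S r s \<Longrightarrow> fraction R S p' q' = fraction R S r' s' \<Longrightarrow>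
      g p q p' q' = g r s r' s'"
  shows "(\<Union>(p, q)\<in>fraction R S r s. \<Union>(p', q')\<in>fraction R S r' s'. g p q p' q') = g r s r' s'"
proof -
  have *: "(r, s) \<in> fraction R S r s" "(r', s') \<in> fraction R S r' s'"
    using assms by (auto simp: mem_fraction)
  have "g p q p' q' = g r s r' s'"
    if "(p, q) \<in> fraction R S r s" "(p', q') \<in> fraction R S r' s'" for p q p' q'
    by (rule g) (use that assms in \<open>simp_all add: mem_fraction\<close>)
  then have "(\<Union>(p, q)\<in>fraction R S r s. \<Union>(p', q')\<in>fraction R S r' s'. g p q p' q') =
      (\<Union>x\<in>fraction R S r s. \<Union>y\<in>fraction R S r' s'. g r s r' s')"
    by (intro SUP_cong refl) (auto split: prod.splits)
  then show ?thesis using * by auto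
qed

abbreviation "Q \<equiv> ring_of_fractions R S"

lemma carrier_fractions: "carrier Q = {fraction R S r s |r s. r \<in> carrier R \<and> s \<in> S}"
  by (auto simp: ring_of_fractions_def quotient_def fraction_def)

lemma fraction_closed [simp, intro]: "r \<in> carrier R \<Longrightarrow> s \<in> S \<Longrightarrow> fraction R S r s \<in> carrier Q"
  by (auto simp: carrier_fractions)

lemma fractionE:
  assumes "x \<in> carrier Q"
  obtains r s where "r \<in> carrier R" "s \<in> S" "x = fraction R S r s"
  using assms by (auto simp: carrier_fractions)

lemma mult_fraction:
  assumes "r \<in> carrier R" "s \<in> S" "r' \<in> carrier R" "s' \<in> S"
  shows "fraction R S r s \<otimes>\<^bsub>Q\<^esub> fraction R S r' s' = fraction R S (r \<otimes> r') (s \<otimes> s')" (is "_ = ?R")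
proof -
  have *: "fraction R S (p \<otimes> p') (q \<otimes> q') = fraction R S (r \<otimes> r') (s \<otimes> s')"
    if pq: "p \<in> carrier R" "q \<in> S" "p' \<in> carrier R" "q' \<in> S"
      and 1: "fraction R S p q = fraction R S r s" "fraction R S p' q' = fraction R S r' s'"
    for p q p' q'
  proof -
    obtain u v where u: "u \<in> S" "u \<otimes> (s \<otimes> p) = u \<otimes> (q \<otimes> r)"
      and v: "v \<in> S" "v \<otimes> (s' \<otimes> p') = v \<otimes> (q' \<otimes> r')"
      using 1 pq assms by (auto simp: fraction_eq_iff)
    have "(u \<otimes> v) \<otimes> ((s \<otimes> s') \<otimes> (p \<otimes> p')) = (u \<otimes> (s \<otimes> p)) \<otimes> (v \<otimes> (s' \<otimes> p'))"
      using pq assms u(1) v(1) by (simp add: m_ac)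
    also have "\<dots> = (u \<otimes> v) \<otimes> ((q \<otimes> q') \<otimes> (r \<otimes> r'))"
      unfolding u v using pq assms u(1) v(1) by (simp add: m_ac)
    finally show ?thesis using pq assms u v S_mult
      by (subst fraction_eq_iff) auto
  qed
  have "(\<Union>(p, q)\<in>fraction R S r s. \<Union>(p', q')\<in>fraction R S r' s'.
      fraction R S (p \<otimes> p') (q \<otimes> q')) = ?R"
    by (rule Un_fractions[OF assms, where g = "\<lambda>p q p' q'. fraction R S (p \<otimes> p') (q \<otimes> q')"]) (rule *)
  then show ?thesis by (simp add: ring_of_fractions_def)
qed

lemma add_fraction:
  assumes "r \<in> carrier R" "s \<in> S" "r' \<in> carrier R" "s' \<in> S"
  shows "fraction R S r s \<oplus>\<^bsub>Q\<^esub> fraction R S r' s' = fraction R S (s' \<otimes> r \<oplus> s \<otimes> r') (s \<otimes> s')" (is "_ = ?R")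
proof -
  have *: "fraction R S (q' \<otimes> p \<oplus> q \<otimes> p') (q \<otimes> q') = fraction R S (s' \<otimes> r \<oplus> s \<otimes> r') (s \<otimes> s')"
    if pq: "p \<in> carrier R" "q \<in> S" "p' \<in> carrier R" "q' \<in> S"
      and 1: "fraction R S p q = fraction R S r s" "fraction R S p' q' = fraction R S r' s'"
    for p q p' q'
  proof -
    obtain u v where u: "u \<in> S" "u \<otimes> (s \<otimes> p) = u \<otimes> (q \<otimes> r)"
      and v: "v \<in> S" "v \<otimes> (s' \<otimes> p') = v \<otimes> (q' \<otimes> r')"
      using 1 pq assms by (auto simp: fraction_eq_iff)
    have "(u \<otimes> v) \<otimes> ((s \<otimes> s') \<otimes> (q' \<otimes> p \<oplus> q \<otimes> p')) =
       (v \<otimes> s' \<otimes> q') \<otimes> (u \<otimes> (s \<otimes> p)) \<oplus> (u \<otimes> s \<otimes> q) \<otimes> (v \<otimes> (s' \<otimes> p'))"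
      using pq assms u(1) v(1) by (simp add: m_ac r_distr)
    also have "\<dots> = (u \<otimes> v) \<otimes> ((q \<otimes> q') \<otimes> (s' \<otimes> r \<oplus> s \<otimes> r'))"
      unfolding u v using pq assms u(1) v(1) by (simp add: m_ac r_distr)
    finally show ?thesis using pq assms u v S_mult
      by (subst fraction_eq_iff) auto
  qed
  have "(\<Union>(p, q)\<in>fraction R S r s. \<Union>(p', q')\<in>fraction R S r' s'.
      fraction R S (q' \<otimes> p \<oplus> q \<otimes> p') (q \<otimes> q')) = ?R"
    by (rule Un_fractions[OF assms, where g = "\<lambda>p q p' q'. fraction R S (q' \<otimes> p \<oplus> q \<otimes> p') (q \<otimes> q')"]) (rule *)
  then show ?thesis by (simp add: ring_of_fractions_def)
qed

lemma one_fractions: "\<one>\<^bsub>Q\<^esub> = fraction R S \<one> \<one>"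
  and zero_fractions: "\<zero>\<^bsub>Q\<^esub> = fraction R S \<zero> \<one>"
  by (auto simp: ring_of_fractions_def)

lemma zero_over: "s \<in> S \<Longrightarrow> fraction R S \<zero> s = \<zero>\<^bsub>Q\<^esub>"
  using S_one unfolding zero_fractions by (intro fraction_eqI) auto

lemma cring_fractions: "cring Q"
proof (rule cringI)
  show "abelian_group Q"
  proof (rule abelian_groupI)
    fix x y assume "x \<in> carrier Q" "y \<in> carrier Q"
    then show "x \<oplus>\<^bsub>Q\<^esub> y \<in> carrier Q" "x \<oplus>\<^bsub>Q\<^esub> y = y \<oplus>\<^bsub>Q\<^esub> x"
      using S_mult by (auto elim!: fractionE simp: add_fraction a_comm m_comm)
  next
    fix x y z assume "x \<in> carrier Q" "y \<in> carrier Q" "z \<in> carrier Q"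
    then show "x \<oplus>\<^bsub>Q\<^esub> y \<oplus>\<^bsub>Q\<^esub> z = x \<oplus>\<^bsub>Q\<^esub> (y \<oplus>\<^bsub>Q\<^esub> z)"
      using S_mult by (auto elim!: fractionE simp: add_fraction a_ac m_ac r_distr)
  next
    fix x assume "x \<in> carrier Q"
    then obtain r s where x: "r \<in> carrier R" "s \<in> S" "x = fraction R S r s"
      by (rule fractionE)
    then show "\<zero>\<^bsub>Q\<^esub> \<oplus>\<^bsub>Q\<^esub> x = x"
      using S_one by (simp add: zero_fractions add_fraction)
    have "fraction R S (\<ominus> r) s \<oplus>\<^bsub>Q\<^esub> x = \<zero>\<^bsub>Q\<^esub>"
      using x S_mult by (simp add: add_fraction r_minus l_neg zero_over)
    then show "\<exists>y\<in>carrier Q. y \<oplus>\<^bsub>Q\<^esub> x = \<zero>\<^bsub>Q\<^esub>"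
      using x by blast
  qed (use S_one in \<open>auto simp: zero_fractions\<close>)
  show "comm_monoid Q"
  proof (rule comm_monoidI)
    fix x y assume "x \<in> carrier Q" "y \<in> carrier Q"
    then show "x \<otimes>\<^bsub>Q\<^esub> y \<in> carrier Q" "x \<otimes>\<^bsub>Q\<^esub> y = y \<otimes>\<^bsub>Q\<^esub> x"
      using S_mult by (auto elim!: fractionE simp: mult_fraction m_comm)
  next
    fix x y z assume "x \<in> carrier Q" "y \<in> carrier Q" "z \<in> carrier Q"
    then show "x \<otimes>\<^bsub>Q\<^esub> y \<otimes>\<^bsub>Q\<^esub> z = x \<otimes>\<^bsub>Q\<^esub> (y \<otimes>\<^bsub>Q\<^esub> z)"
      using S_mult by (auto elim!: fractionE simp: mult_fraction m_ac)
  next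
    fix x assume "x \<in> carrier Q"
    then show "\<one>\<^bsub>Q\<^esub> \<otimes>\<^bsub>Q\<^esub> x = x"
      using S_one by (auto elim!: fractionE simp: one_fractions mult_fraction)
  qed (use S_one in \<open>auto simp: one_fractions\<close>)
  fix x y z assume "x \<in> carrier Q" "y \<in> carrier Q" "z \<in> carrier Q"
  then obtain r s r' s' r'' s'' where *: "r \<in> carrier R" "s \<in> S" "r' \<in> carrier R" "s' \<in> S"
      "r'' \<in> carrier R" "s'' \<in> S"
    and x: "x = fraction R S r s" and y: "y = fraction R S r' s'" and z: "z = fraction R S r'' s''"
    by (elim fractionE)
  have "fraction R S ((s' \<otimes> r \<oplus> s \<otimes> r') \<otimes> r'') (s \<otimes> s' \<otimes> s'') =
      fraction R S ((s' \<otimes> s'') \<otimes> (r \<otimes> r'') \<oplus> (s \<otimes> s'') \<otimes> (r' \<otimes> r'')) (s \<otimes> s'' \<otimes> (s' \<otimes> s''))"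
    using * S_mult by (intro fraction_eqI) (auto simp: m_ac r_distr l_distr)
  then show "(x \<oplus>\<^bsub>Q\<^esub> y) \<otimes>\<^bsub>Q\<^esub> z = x \<otimes>\<^bsub>Q\<^esub> z \<oplus>\<^bsub>Q\<^esub> y \<otimes>\<^bsub>Q\<^esub> z"
    using * S_mult by (simp add: x y z mult_fraction add_fraction)
qed

definition \<iota> where "\<iota> r = fraction R S r \<one>"

lemma ring_hom_iota: "\<iota> \<in> ring_hom R Q"
  using S_one by (intro ring_hom_memI) (auto simp: \<iota>_def mult_fraction add_fraction one_fractions)

lemma iota_unit: "s \<in> S \<Longrightarrow> fraction R S \<one> s \<otimes>\<^bsub>Q\<^esub> \<iota> s = \<one>\<^bsub>Q\<^esub>"
  using S_one S_mult by (simp add: \<iota>_def mult_fraction one_fractions) (rule fraction_eqI, auto)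

lemma fraction_mult_iota: "r \<in> carrier R \<Longrightarrow> s \<in> S \<Longrightarrow> fraction R S r s \<otimes>\<^bsub>Q\<^esub> \<iota> s = \<iota> r"
  using S_one S_mult by (simp add: \<iota>_def mult_fraction) (rule fraction_eqI, auto simp: m_ac)

end

section \<open>Ideals of a localized quotient\<close>

text \<open>The ring \<open>B\<close> below is the localization of \<open>R / I\<close> at \<open>S\<close>, formed as a quotient of the ring of
  fractions \<open>Q\<close>, and \<open>\<phi>\<close> is the canonical map from \<open>R\<close> to it. Besides being a homomorphism, \<open>\<phi>\<close> enters
  only through \<open>phi_eq_zero\<close>, \<open>phi_unit\<close> and \<open>phi_frac\<close>.\<close>

locale localized_quotient = multiplicative_subset + ideal I R for I
begin

definition "extended_ideal = genideal Q (\<iota> ` I)"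
definition "B = Q Quot extended_ideal"
definition "\<phi> r = extended_ideal +>\<^bsub>Q\<^esub> \<iota> r"

sublocale Q: cring Q by (rule cring_fractions)

lemma iota_closed [simp, intro]: "r \<in> carrier R \<Longrightarrow> \<iota> r \<in> carrier Q"
  using S_one by (auto simp: \<iota>_def)

lemma ideal_extended: "ideal extended_ideal Q"
  unfolding extended_ideal_def by (rule Q.genideal_ideal) (auto intro: Icarr)

text \<open>The kernel of \<open>\<phi>\<close> is found by writing the elements of the extended ideal as single fractions.\<close>

lemma extended_ideal_eq: "extended_ideal = {fraction R S i s |i s. i \<in> I \<and> s \<in> S}" (is "_ = ?K")
proof
  have mem: "fraction R S i s \<in> ?K" if "i \<in> I" "s \<in> S" for i s using that by blast
  have "ideal ?K Q"
  proof (rule idealI[OF Q.ring_axioms])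
    show "subgroup ?K (add_monoid Q)"
    proof (rule Q.add.subgroupI)
      show "?K \<subseteq> carrier Q" by (auto intro: Icarr)
      show "?K \<noteq> {}" using S_one zero_closed by blast
    next
      fix a assume "a \<in> ?K"
      then obtain i s where a: "i \<in> I" "s \<in> S" "a = fraction R S i s" by blast
      have "\<ominus>\<^bsub>Q\<^esub> a = fraction R S (\<ominus> i) s"
        using a S_mult Icarr
        by (intro Q.minus_equality) (auto simp: add_fraction r_minus l_neg zero_over)
      moreover have "\<ominus> i \<in> I" using a by (simp add: additive_subgroup.a_inv_closed)
      ultimately show "\<ominus>\<^bsub>Q\<^esub> a \<in> ?K" using a by auto
    next
      fix a b assume "a \<in> ?K" "b \<in> ?K"
      then obtain i s j t where ab: "i \<in> I" "s \<in> S" "j \<in> I" "t \<in> S"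
        "a = fraction R S i s" "b = fraction R S j t" by blast
      then have "t \<otimes> i \<oplus> s \<otimes> j \<in> I"
        by (intro additive_subgroup.a_closed[OF is_additive_subgroup] I_l_closed) auto
      then show "a \<oplus>\<^bsub>Q\<^esub> b \<in> ?K"
        using ab S_mult Icarr by (auto simp: add_fraction)
    qed
    fix a x assume "a \<in> ?K" "x \<in> carrier Q"
    then obtain i s r t where ax: "i \<in> I" "s \<in> S" "r \<in> carrier R" "t \<in> S"
      "a = fraction R S i s" "x = fraction R S r t" unfolding carrier_fractions by blast
    then show "x \<otimes>\<^bsub>Q\<^esub> a \<in> ?K"
      using mem[of "r \<otimes> i" "t \<otimes> s"] S_mult I_l_closed Icarr by (simp only: mult_fraction)
    from ax show "a \<otimes>\<^bsub>Q\<^esub> x \<in> ?K"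
      using mem[of "i \<otimes> r" "s \<otimes> t"] S_mult I_r_closed Icarr by (simp only: mult_fraction)
  qed
  moreover have "\<iota> ` I \<subseteq> ?K" using S_one by (auto simp: \<iota>_def)
  ultimately show "extended_ideal \<subseteq> ?K" unfolding extended_ideal_def by (intro Q.genideal_minimal)
  show "?K \<subseteq> extended_ideal"
  proof clarify
    fix i s assume is1: "i \<in> I" "s \<in> S"
    have "\<iota> i \<in> extended_ideal" unfolding extended_ideal_def using is1 Icarr by (intro subsetD[OF Q.genideal_self]) auto
    then have "fraction R S \<one> s \<otimes>\<^bsub>Q\<^esub> \<iota> i \<in> extended_ideal"
      using is1 by (intro ideal.I_l_closed[OF ideal_extended]) auto
    then show "fraction R S i s \<in> extended_ideal"
      using is1 S_one Icarr by (simp add: \<iota>_def mult_fraction)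
  qed
qed

lemma cring_B: "cring B"
  unfolding B_def by (rule ideal.quotient_is_cring[OF ideal_extended cring_fractions])

sublocale B: cring B by (rule cring_B)

lemma phi_hom: "\<phi> \<in> ring_hom R B"
proof -
  have "(\<lambda>x. extended_ideal +>\<^bsub>Q\<^esub> x) \<circ> \<iota> \<in> ring_hom R B"
    unfolding B_def by (rule ring_hom_trans[OF ring_hom_iota ideal.rcos_ring_hom[OF ideal_extended]])
  moreover have "(\<lambda>x. extended_ideal +>\<^bsub>Q\<^esub> x) \<circ> \<iota> = \<phi>" by (auto simp: \<phi>_def)
  ultimately show ?thesis by simp
qed

sublocale \<phi>: ring_hom_cring R B \<phi>
  by (unfold_locales) (rule phi_hom)

lemma phi_eq_zero: "r \<in> carrier R \<Longrightarrow> \<phi> r = \<zero>\<^bsub>B\<^esub> \<longleftrightarrow> (\<exists>s\<in>S. s \<otimes> r \<in> I)"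
proof -
  assume r: "r \<in> carrier R"
  have "\<phi> r = \<zero>\<^bsub>B\<^esub> \<longleftrightarrow> \<iota> r \<in> extended_ideal"
  proof
    assume "\<phi> r = \<zero>\<^bsub>B\<^esub>"
    then show "\<iota> r \<in> extended_ideal" using ideal.rcos_const_imp_mem[OF ideal_extended, of "\<iota> r"] r
      by (simp add: \<phi>_def B_def FactRing_def)
  next
    assume "\<iota> r \<in> extended_ideal"
    then show "\<phi> r = \<zero>\<^bsub>B\<^esub>" using Q.a_rcos_zero[OF ideal_extended]
      by (simp add: \<phi>_def B_def FactRing_def)
  qed
  also have "\<dots> \<longleftrightarrow> (\<exists>s\<in>S. s \<otimes> r \<in> I)"
  proof
    assume "\<iota> r \<in> extended_ideal"
    then obtain i s where is1: "i \<in> I" "s \<in> S" "fraction R S r \<one> = fraction R S i s"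
      unfolding extended_ideal_eq \<iota>_def by blast
    then obtain u where u: "u \<in> S" "u \<otimes> (s \<otimes> r) = u \<otimes> (\<one> \<otimes> i)"
      using r S_one Icarr by (auto simp: fraction_eq_iff)
    then have "(u \<otimes> s) \<otimes> r = u \<otimes> i" using r is1 Icarr by (simp add: m_assoc)
    then show "\<exists>s\<in>S. s \<otimes> r \<in> I" using u is1 S_mult I_l_closed by (metis S_closed)
  next
    assume "\<exists>s\<in>S. s \<otimes> r \<in> I"
    then obtain s where s: "s \<in> S" "s \<otimes> r \<in> I" by blast
    then have "\<iota> r = fraction R S (s \<otimes> r) s"
      unfolding \<iota>_def using r S_one by (intro fraction_eqI) auto
    then show "\<iota> r \<in> extended_ideal" unfolding extended_ideal_eq using s by blast
  qed
  finally show ?thesis .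
qed

lemma phi_unit: "s \<in> S \<Longrightarrow> \<exists>t\<in>carrier B. t \<otimes>\<^bsub>B\<^esub> \<phi> s = \<one>\<^bsub>B\<^esub>"
proof -
  assume s: "s \<in> S"
  note h = ideal.rcos_ring_hom[OF ideal_extended, folded B_def]
  have "(extended_ideal +>\<^bsub>Q\<^esub> fraction R S \<one> s) \<otimes>\<^bsub>B\<^esub> \<phi> s = \<one>\<^bsub>B\<^esub>"
    using s ring_hom_mult[OF h, of "fraction R S \<one> s" "\<iota> s"] ring_hom_one[OF h]
    by (simp add: iota_unit \<phi>_def)
  then show ?thesis using ring_hom_closed[OF h, of "fraction R S \<one> s"] s by blast
qed

lemma phi_frac: "b \<in> carrier B \<Longrightarrow> \<exists>r\<in>carrier R. \<exists>s\<in>S. b \<otimes>\<^bsub>B\<^esub> \<phi> s = \<phi> r"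
proof -
  assume "b \<in> carrier B"
  then obtain q where q: "q \<in> carrier Q" "b = extended_ideal +>\<^bsub>Q\<^esub> q"
    by (auto simp: B_def FactRing_def A_RCOSETS_def' )
  then obtain r s where rs: "r \<in> carrier R" "s \<in> S" "q = fraction R S r s"
    by (elim fractionE)
  note h = ideal.rcos_ring_hom[OF ideal_extended, folded B_def]
  have "b \<otimes>\<^bsub>B\<^esub> \<phi> s = \<phi> r"
    using rs q ring_hom_mult[OF h, of "fraction R S r s" "\<iota> s"]
    by (simp add: fraction_mult_iota \<phi>_def)
  then show ?thesis using rs by blast
qed

text \<open>These are the ideals of \<open>R\<close> that come from ideals of \<open>B\<close>.\<close>

definition "saturated K \<longleftrightarrow> ideal K R \<and> I \<subseteq> K \<and> (\<forall>s\<in>S. \<forall>r\<in>carrier R. s \<otimes> r \<in> K \<longrightarrow> r \<in> K)"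
definition "contr J = {r \<in> carrier R. \<phi> r \<in> J}"
definition "ext K = {b \<in> carrier B. \<exists>r\<in>K. \<exists>s\<in>S. b \<otimes>\<^bsub>B\<^esub> \<phi> s = \<phi> r}"

text \<open>Saturation of a contracted ideal reflects that \<open>\<phi> s\<close> is a unit for \<open>s \<in> S\<close>.\<close>

lemma contr_saturated:
  assumes "ideal J B"
  shows "saturated (contr J)"
proof -
  interpret J: ideal J B by fact
  have "ideal (contr J) R"
  proof (rule idealI[OF ring_axioms])
    show "subgroup (contr J) (add_monoid R)"
      by (rule add.subgroupI) (auto simp: contr_def J.a_closed J.zero_closed
          \<phi>.hom_a_inv J.a_inv_closed intro!: exI[of _ \<zero>])
  qed (auto simp: contr_def J.I_l_closed J.I_r_closed)
  moreover have "I \<subseteq> contr J"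
  proof
    fix i assume i: "i \<in> I"
    then have "\<phi> i = \<zero>\<^bsub>B\<^esub>" using S_one Icarr by (subst phi_eq_zero) (auto intro!: bexI[of _ \<one>])
    then show "i \<in> contr J" using i Icarr by (simp add: contr_def J.zero_closed)
  qed
  moreover have "r \<in> contr J" if "s \<in> S" "r \<in> carrier R" "s \<otimes> r \<in> contr J" for s r
  proof -
    obtain t where t: "t \<in> carrier B" "t \<otimes>\<^bsub>B\<^esub> \<phi> s = \<one>\<^bsub>B\<^esub>" using phi_unit[OF \<open>s \<in> S\<close>] by blast
    have "t \<otimes>\<^bsub>B\<^esub> (\<phi> s \<otimes>\<^bsub>B\<^esub> \<phi> r) \<in> J"
      using that t by (intro J.I_l_closed[OF _ t(1)]) (simp add: contr_def)
    then have "\<phi> r \<in> J" using that t by (simp add: B.m_assoc[symmetric])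
    then show ?thesis using that by (simp add: contr_def)
  qed
  ultimately show ?thesis unfolding saturated_def by blast
qed

text \<open>Every element of \<open>B\<close> becomes an element of the image of \<open>R\<close> after multiplication by a unit
  \<open>\<phi> s\<close>, so an ideal of \<open>B\<close> is determined by its contraction.\<close>

lemma ext_contr:
  assumes "ideal J B"
  shows "ext (contr J) = J"
proof -
  interpret J: ideal J B by fact
  have "b \<in> J" if b: "b \<in> carrier B" "r \<in> contr J" "s \<in> S" "b \<otimes>\<^bsub>B\<^esub> \<phi> s = \<phi> r" for b r s
  proof -
    obtain t where t: "t \<in> carrier B" "t \<otimes>\<^bsub>B\<^esub> \<phi> s = \<one>\<^bsub>B\<^esub>" using phi_unit b by blast
    have "t \<otimes>\<^bsub>B\<^esub> (b \<otimes>\<^bsub>B\<^esub> \<phi> s) \<in> J"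
      using b t by (intro J.I_l_closed[OF _ t(1)]) (simp add: contr_def)
    moreover have "t \<otimes>\<^bsub>B\<^esub> (b \<otimes>\<^bsub>B\<^esub> \<phi> s) = b \<otimes>\<^bsub>B\<^esub> (t \<otimes>\<^bsub>B\<^esub> \<phi> s)"
      using b t by (intro B.m_lcomm) auto
    ultimately show ?thesis using b t by simp
  qed
  moreover have "b \<in> ext (contr J)" if "b \<in> J" for b
  proof -
    have "b \<in> carrier B" using that J.Icarr by blast
    then obtain r s where "r \<in> carrier R" "s \<in> S" "b \<otimes>\<^bsub>B\<^esub> \<phi> s = \<phi> r" using phi_frac by blast
    then show ?thesis using that \<open>b \<in> carrier B\<close> J.I_r_closed[of b "\<phi> s"]
      by (auto simp: ext_def contr_def)
  qed
  ultimately show ?thesis by (auto simp: ext_def)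
qed

text \<open>If \<open>\<phi> r \<otimes> \<phi> s = \<phi> k\<close> with \<open>k \<in> K\<close>, then some \<open>t \<in> S\<close> moves \<open>r \<otimes> s \<ominus> k\<close> into \<open>I\<close>; hence \<open>t \<otimes> s \<otimes> r\<close> lies in
  \<open>K\<close>, and saturation gives \<open>r \<in> K\<close>.\<close>

lemma contr_ext:
  assumes "saturated K"
  shows "contr (ext K) = K"
proof -
  interpret K: ideal K R using assms by (simp add: saturated_def)
  have "r \<in> K" if r: "r \<in> carrier R" "k \<in> K" "s \<in> S" "\<phi> r \<otimes>\<^bsub>B\<^esub> \<phi> s = \<phi> k" for r k s
  proof -
    note [simp] = K.Icarr[OF r(2)]
    have "\<phi> (r \<otimes> s \<ominus> k) = \<zero>\<^bsub>B\<^esub>" using r by (simp add: minus_eq \<phi>.hom_a_inv B.r_neg)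
    then obtain t where t: "t \<in> S" "t \<otimes> (r \<otimes> s \<ominus> k) \<in> I" using r by (auto simp: phi_eq_zero)
    then have "t \<otimes> (r \<otimes> s \<ominus> k) \<in> K" using assms unfolding saturated_def by blast
    moreover have "t \<otimes> k \<in> K" using t r by (intro K.I_l_closed) auto
    ultimately have "t \<otimes> (r \<otimes> s \<ominus> k) \<oplus> t \<otimes> k \<in> K" by (rule K.a_closed)
    also have "t \<otimes> (r \<otimes> s \<ominus> k) \<oplus> t \<otimes> k = (t \<otimes> s) \<otimes> r" using r t
      by (simp add: r_distr[symmetric] minus_eq a_assoc l_neg) (simp add: m_ac)
    finally show "r \<in> K" using assms r(1) S_mult[OF t(1) r(3)] unfolding saturated_def by blast
  qed
  moreover have "K \<subseteq> contr (ext K)"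
  proof
    fix k assume k: "k \<in> K"
    then have "\<phi> k \<otimes>\<^bsub>B\<^esub> \<phi> \<one> = \<phi> k" using K.Icarr by simp
    then show "k \<in> contr (ext K)" using k K.Icarr S_one unfolding contr_def ext_def by blast
  qed
  ultimately show ?thesis by (auto simp: contr_def ext_def)
qed

lemma ext_ideal:
  assumes "saturated K"
  shows "ideal (ext K) B"
proof -
  interpret K: ideal K R using assms by (simp add: saturated_def)
  show ?thesis
  proof (rule idealI[OF B.ring_axioms])
    show "subgroup (ext K) (add_monoid B)"
    proof (rule B.add.subgroupI)
      show "ext K \<subseteq> carrier B" by (auto simp: ext_def)
      have "\<zero> \<in> contr (ext K)" using contr_ext[OF assms] by simp
      then show "ext K \<noteq> {}" by (auto simp: contr_def)
    next
      fix a assume "a \<in> ext K"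
      then obtain r s where a: "a \<in> carrier B" "r \<in> K" "s \<in> S" "a \<otimes>\<^bsub>B\<^esub> \<phi> s = \<phi> r"
        by (auto simp: ext_def)
      then have "\<ominus>\<^bsub>B\<^esub> a \<otimes>\<^bsub>B\<^esub> \<phi> s = \<phi> (\<ominus> r)"
        using K.Icarr by (simp add: B.l_minus \<phi>.hom_a_inv)
      then show "\<ominus>\<^bsub>B\<^esub> a \<in> ext K" using a K.a_inv_closed unfolding ext_def by blast
    next
      fix a b assume "a \<in> ext K" "b \<in> ext K"
      then obtain r s p t where a: "a \<in> carrier B" "r \<in> K" "s \<in> S" "a \<otimes>\<^bsub>B\<^esub> \<phi> s = \<phi> r"
        and b: "b \<in> carrier B" "p \<in> K" "t \<in> S" "b \<otimes>\<^bsub>B\<^esub> \<phi> t = \<phi> p"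
        by (auto simp: ext_def)
      have c: "r \<in> carrier R" "p \<in> carrier R" using a b K.Icarr by auto
      have "(a \<oplus>\<^bsub>B\<^esub> b) \<otimes>\<^bsub>B\<^esub> \<phi> (s \<otimes> t) =
          \<phi> t \<otimes>\<^bsub>B\<^esub> (a \<otimes>\<^bsub>B\<^esub> \<phi> s) \<oplus>\<^bsub>B\<^esub> \<phi> s \<otimes>\<^bsub>B\<^esub> (b \<otimes>\<^bsub>B\<^esub> \<phi> t)"
        using a(1,3) b(1,3) by (simp add: B.l_distr B.r_distr B.m_ac)
      also have "\<dots> = \<phi> (t \<otimes> r \<oplus> s \<otimes> p)" unfolding a b using a b c by simp
      finally have "(a \<oplus>\<^bsub>B\<^esub> b) \<otimes>\<^bsub>B\<^esub> \<phi> (s \<otimes> t) = \<phi> (t \<otimes> r \<oplus> s \<otimes> p)" .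
      moreover have "t \<otimes> r \<oplus> s \<otimes> p \<in> K" using a b by (intro K.a_closed K.I_l_closed) auto
      moreover have "s \<otimes> t \<in> S" using a b S_mult by blast
      ultimately show "a \<oplus>\<^bsub>B\<^esub> b \<in> ext K"
        using a(1) b(1) B.a_closed unfolding ext_def by blast
    qed
    fix a x assume "a \<in> ext K" "x \<in> carrier B"
    then obtain r s p t where a: "a \<in> carrier B" "r \<in> K" "s \<in> S" "a \<otimes>\<^bsub>B\<^esub> \<phi> s = \<phi> r"
      and x: "x \<in> carrier B" "p \<in> carrier R" "t \<in> S" "x \<otimes>\<^bsub>B\<^esub> \<phi> t = \<phi> p"
      using phi_frac[of x] unfolding ext_def by blast
    have c: "r \<in> carrier R" using a K.Icarr by auto
    have "(x \<otimes>\<^bsub>B\<^esub> a) \<otimes>\<^bsub>B\<^esub> \<phi> (s \<otimes> t) = (x \<otimes>\<^bsub>B\<^esub> \<phi> t) \<otimes>\<^bsub>B\<^esub> (a \<otimes>\<^bsub>B\<^esub> \<phi> s)"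
      using a(1,3) x(1,3) by (simp add: B.m_ac)
    also have "\<dots> = \<phi> (p \<otimes> r)" unfolding a x using x c by simp
    finally have "(x \<otimes>\<^bsub>B\<^esub> a) \<otimes>\<^bsub>B\<^esub> \<phi> (s \<otimes> t) = \<phi> (p \<otimes> r)" .
    moreover have "p \<otimes> r \<in> K" using a x by (intro K.I_l_closed)
    moreover have "s \<otimes> t \<in> S" using a x S_mult by blast
    ultimately show "x \<otimes>\<^bsub>B\<^esub> a \<in> ext K"
      using a(1) x(1) B.m_closed unfolding ext_def by blast
    then show "a \<otimes>\<^bsub>B\<^esub> x \<in> ext K" using a x by (simp add: B.m_comm)
  qed
qed

definition "saturated_chain n K \<longleftrightarrow>
  (\<exists>C. (\<forall>i\<le>n. saturated (C i) \<and> C i \<subseteq> K) \<and> (\<forall>i<n. C i \<subset> C (Suc i)))"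

lemma contr_subset_iff:
  "ideal J B \<Longrightarrow> ideal J' B \<Longrightarrow> contr J \<subseteq> contr J' \<longleftrightarrow> J \<subseteq> J'"
proof
  assume "ideal J B" "ideal J' B" "contr J \<subseteq> contr J'"
  moreover from this have "ext (contr J) \<subseteq> ext (contr J')" by (auto simp: ext_def)
  ultimately show "J \<subseteq> J'" by (simp add: ext_contr)
qed (auto simp: contr_def)

lemma ideal_length_eq:
  assumes J: "ideal J B"
  shows "ideal_length B J = (SUP n \<in> {n. saturated_chain n (contr J)}. enat n)"
proof -
  have "(\<exists>C. (\<forall>i\<le>n. ideal (C i) B \<and> C i \<subseteq> J) \<and> (\<forall>i<n. C i \<subset> C (Suc i))) \<longleftrightarrow> saturated_chain n (contr J)" for n
  proof
    assume "\<exists>C. (\<forall>i\<le>n. ideal (C i) B \<and> C i \<subseteq> J) \<and> (\<forall>i<n. C i \<subset> C (Suc i))"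
    then obtain C where C: "\<forall>i\<le>n. ideal (C i) B \<and> C i \<subseteq> J" "\<forall>i<n. C i \<subset> C (Suc i)" by blast
    then have "contr (C i) \<subset> contr (C (Suc i))" if "i < n" for i
      using that contr_subset_iff by (metis Suc_leI less_imp_le subset_not_subset_eq)
    then show "saturated_chain n (contr J)" unfolding saturated_chain_def using C J
      by (intro exI[of _ "\<lambda>i. contr (C i)"]) (auto intro: contr_saturated simp: contr_subset_iff)
  next
    assume "saturated_chain n (contr J)"
    then obtain C where C: "\<forall>i\<le>n. saturated (C i) \<and> C i \<subseteq> contr J" "\<forall>i<n. C i \<subset> C (Suc i)"
      unfolding saturated_chain_def by blast
    have *: "ideal (ext (C i)) B \<and> contr (ext (C i)) = C i" if "i \<le> n" for i
      using C that ext_ideal contr_ext by blast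
    have "ext (C i) \<subseteq> J" if "i \<le> n" for i
      using C * that contr_subset_iff[OF _ J, of "ext (C i)"] by auto
    moreover have "ext (C i) \<subset> ext (C (Suc i))" if "i < n" for i
    proof -
      have "contr (ext (C i)) \<subset> contr (ext (C (Suc i)))" using C(2) *[of i] *[of "Suc i"] that by simp
      then show ?thesis using contr_subset_iff *[of i] *[of "Suc i"] that
        by (metis Suc_leI less_imp_le psubset_eq subset_not_subset_eq)
    qed
    ultimately show "\<exists>C. (\<forall>i\<le>n. ideal (C i) B \<and> C i \<subseteq> J) \<and> (\<forall>i<n. C i \<subset> C (Suc i))"
      using * by (intro exI[of _ "\<lambda>i. ext (C i)"]) auto
  qed
  then show ?thesis unfolding ideal_length_def by simp
qed

text \<open>The multiplicity can thus be computed inside \<open>R\<close>: it suffices to exhibit a saturated ideal \<open>K0\<close>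
  whose chains have maximal length \<open>n\<close>, while every saturated ideal not contained in it has chains
  of every length.\<close>

lemma largest_length:
  assumes K0: "saturated K0" and n: "saturated_chain n K0" and max: "\<And>m. saturated_chain m K0 \<Longrightarrow> m \<le> n"
    and inf: "\<And>K m. saturated K \<Longrightarrow> \<not> K \<subseteq> K0 \<Longrightarrow> saturated_chain m K"
  shows "ideal_length B (THE J. largest_finite_length_ideal B J) = enat n"
proof -
  note J0 = ext_ideal[OF K0]
  have len: "ideal_length B (ext K0) = enat n"
    unfolding ideal_length_eq[OF J0] contr_ext[OF K0]
    using n max by (intro antisym SUP_least) (auto intro: SUP_upper)
  have sub: "J \<subseteq> ext K0" if J: "ideal J B" "ideal_length B J < \<infinity>" for J
  proof (rule ccontr)
    assume "\<not> J \<subseteq> ext K0"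
    then have "\<not> contr J \<subseteq> K0" using contr_subset_iff[OF J(1) J0] contr_ext[OF K0] by simp
    then have "saturated_chain m (contr J)" for m using inf contr_saturated[OF J(1)] by blast
    then have "enat m \<le> ideal_length B J" for m
      unfolding ideal_length_eq[OF J(1)] by (intro SUP_upper) auto
    with J(2) show False by (metis enat_ord_simps(1) less_infinityE not_less_eq_eq order_refl)
  qed
  have "(THE J. largest_finite_length_ideal B J) = ext K0"
  proof (rule the_equality)
    show "largest_finite_length_ideal B (ext K0)"
      unfolding largest_finite_length_ideal_def using J0 len sub by auto
    then show "J = ext K0" if "largest_finite_length_ideal B J" for J
      using that unfolding largest_finite_length_ideal_def by blast
  qed
  then show ?thesis using len by simp
qed

text \<open>Nakayama's lemma for principal ideals. The hypothesis \<open>Jac\<close> puts the image of \<open>x\<close> into the Jacobson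
  radical of \<open>B\<close>. If the ideals generated by the images of \<open>x [^] n \<otimes> r\<close> and \<open>x [^] Suc n \<otimes> r\<close> agreed,
  then \<open>(s \<ominus> c \<otimes> x) \<otimes> (x [^] n \<otimes> r)\<close> would vanish in \<open>B\<close> for some \<open>s \<in> S\<close>, and so would
  \<open>x [^] n \<otimes> r\<close> itself.\<close>

lemma descending_chain:
  assumes K: "saturated K" and r: "r \<in> K" and x: "x \<in> carrier R"
    and Jac: "\<And>s c. s \<in> S \<Longrightarrow> c \<in> carrier R \<Longrightarrow> s \<ominus> c \<otimes> x \<in> S"
    and nz: "\<And>(n::nat) t. t \<in> S \<Longrightarrow> t \<otimes> (x [^] n \<otimes> r) \<notin> I"
  shows "saturated_chain m K"
proof -
  have rR: "r \<in> carrier R" using K r ideal.Icarr unfolding saturated_def by metis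
  define q where "q n = \<phi> (x [^] (n::nat) \<otimes> r)" for n
  have q: "q n \<in> carrier B" for n using x rR by (simp add: q_def)
  have qS: "q (Suc n) = \<phi> x \<otimes>\<^bsub>B\<^esub> q n" for n
  proof -
    have "x [^] Suc n \<otimes> r = x \<otimes> (x [^] n \<otimes> r)" using x rR by (simp add: m_ac)
    then show ?thesis using x rR by (simp add: q_def)
  qed
  have qK: "q n \<in> ext K" for n
  proof (induction n)
    case 0
    have "r \<in> contr (ext K)" using contr_ext[OF K] r by simp
    then show ?case using rR by (simp add: contr_def q_def)
  next
    case (Suc n)
    then show ?case unfolding qS using x by (intro ideal.I_l_closed[OF ext_ideal[OF K]]) auto
  qed
  define C where "C n = PIdl\<^bsub>B\<^esub> q n" for n
  have C: "ideal (C n) B" for n unfolding C_def by (rule B.cgenideal_ideal[OF q])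
  have CK: "C n \<subseteq> ext K" for n
    unfolding C_def by (rule B.cgenideal_minimal[OF ext_ideal[OF K] qK])
  have le: "C (Suc n) \<subseteq> C n" for n
  proof -
    have "q n \<in> C n" unfolding C_def by (rule B.cgenideal_self[OF q])
    then have "q (Suc n) \<in> C n" unfolding qS using x by (intro ideal.I_l_closed[OF C]) auto
    then show ?thesis unfolding C_def[of "Suc n"] by (rule B.cgenideal_minimal[OF C])
  qed
  have ne: "C (Suc n) \<noteq> C n" for n
  proof
    assume "C (Suc n) = C n"
    then have "q n \<in> C (Suc n)" unfolding C_def using B.cgenideal_self[OF q] by simp
    then obtain b where b: "b \<in> carrier B" "q n = b \<otimes>\<^bsub>B\<^esub> q (Suc n)"
      unfolding C_def cgenideal_def by blast
    obtain c s where cs: "c \<in> carrier R" "s \<in> S" "b \<otimes>\<^bsub>B\<^esub> \<phi> s = \<phi> c" using phi_frac[OF b(1)] by blast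
    have "\<phi> s \<otimes>\<^bsub>B\<^esub> q n = \<phi> s \<otimes>\<^bsub>B\<^esub> (b \<otimes>\<^bsub>B\<^esub> (\<phi> x \<otimes>\<^bsub>B\<^esub> q n))"
      using b(2) by (simp add: qS)
    also have "\<dots> = (b \<otimes>\<^bsub>B\<^esub> \<phi> s) \<otimes>\<^bsub>B\<^esub> (\<phi> x \<otimes>\<^bsub>B\<^esub> q n)"
      using cs(2) b(1) x q[of n] by (simp add: B.m_ac)
    also have "\<dots> = \<phi> (c \<otimes> x) \<otimes>\<^bsub>B\<^esub> q n"
      unfolding cs(3) using cs(1) x q[of n] by (simp add: B.m_assoc)
    finally have e: "\<phi> s \<otimes>\<^bsub>B\<^esub> q n = \<phi> (c \<otimes> x) \<otimes>\<^bsub>B\<^esub> q n" .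
    have "\<phi> ((s \<ominus> c \<otimes> x) \<otimes> (x [^] n \<otimes> r)) = (\<phi> s \<ominus>\<^bsub>B\<^esub> \<phi> (c \<otimes> x)) \<otimes>\<^bsub>B\<^esub> q n"
      using cs x rR by (simp add: q_def minus_eq B.minus_eq \<phi>.hom_a_inv del: \<phi>.hom_mult add: \<phi>.hom_mult[of "c" x] \<phi>.hom_mult[of "s \<oplus> \<ominus> (c \<otimes> x)" "x [^] n \<otimes> r"])
    also have "\<dots> = \<phi> s \<otimes>\<^bsub>B\<^esub> q n \<ominus>\<^bsub>B\<^esub> \<phi> (c \<otimes> x) \<otimes>\<^bsub>B\<^esub> q n"
      using cs x q[of n] by (simp add: B.minus_eq B.l_distr B.l_minus)
    also have "\<dots> = \<zero>\<^bsub>B\<^esub>" unfolding e using cs x q[of n] by (simp add: B.minus_eq B.r_neg)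
    finally obtain t where t: "t \<in> S" "t \<otimes> ((s \<ominus> c \<otimes> x) \<otimes> (x [^] n \<otimes> r)) \<in> I"
      using phi_eq_zero[of "(s \<ominus> c \<otimes> x) \<otimes> (x [^] n \<otimes> r)"] cs x rR by auto
    have "(t \<otimes> (s \<ominus> c \<otimes> x)) \<otimes> (x [^] n \<otimes> r) \<in> I"
      using t cs x rR by (simp add: m_assoc)
    moreover have "t \<otimes> (s \<ominus> c \<otimes> x) \<in> S" using t(1) cs Jac S_mult by blast
    ultimately show False using nz by blast
  qed
  have "contr (C (Suc n)) \<subset> contr (C n)" for n
    using contr_subset_iff[OF C C] le[of n] ne[of n] by blast
  moreover have "contr (C n) \<subseteq> K" for n
    using contr_subset_iff[OF C ext_ideal[OF K]] CK[of n] contr_ext[OF K] by simp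
  ultimately show ?thesis unfolding saturated_chain_def
    by (intro exI[of _ "\<lambda>i. contr (C (m - i))"])
       (auto intro: contr_saturated C, metis Suc_diff_Suc psubset_eq subsetD, metis Suc_diff_Suc psubset_eq)
qed

end

section \<open>Polynomials supported on a set of exponents\<close>

abbreviation keys :: "('a \<Rightarrow>\<^sub>0 'b::zero) \<Rightarrow> 'a set" where "keys \<equiv> Poly_Mapping.keys"
abbreviation lookup :: "('a \<Rightarrow>\<^sub>0 'b::zero) \<Rightarrow> 'a \<Rightarrow> 'b" where "lookup \<equiv> Poly_Mapping.lookup"

lemma semigroup_ring_simps [simp]:
  "mult (semigroup_ring A) = (*)" "one (semigroup_ring A) = 1"
  "zero (semigroup_ring A) = 0" "add (semigroup_ring A) = (+)"
  "p \<in> carrier (semigroup_ring A) \<longleftrightarrow> Poly_Mapping.keys p \<subseteq> nat_span A"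
  by (auto simp: semigroup_ring_def)

lemma keys_mult_subset:
  fixes p q :: "'a::monoid_add \<Rightarrow>\<^sub>0 'k::semiring_0"
  assumes "\<And>a b. a \<in> keys p \<Longrightarrow> b \<in> keys q \<Longrightarrow> a + b \<in> U"
  shows "keys (p * q) \<subseteq> U"
  using keys_mult[of p q] assms by blast

lemma cring_semigroup_ring: "cring (semigroup_ring A :: (int ^ 'd::finite \<Rightarrow>\<^sub>0 'k::field) ring)"
proof (rule cringI)
  show "abelian_group (semigroup_ring A :: (int ^ 'd::finite \<Rightarrow>\<^sub>0 'k::field) ring)"
  proof (rule abelian_groupI)
    fix x y :: "int ^ 'd::finite \<Rightarrow>\<^sub>0 'k"
    assume "x \<in> carrier (semigroup_ring A)" "y \<in> carrier (semigroup_ring A)"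
    then show "x \<oplus>\<^bsub>semigroup_ring A\<^esub> y \<in> carrier (semigroup_ring A)"
      using keys_add[of x y] by auto
  next
    fix x :: "int ^ 'd::finite \<Rightarrow>\<^sub>0 'k" assume "x \<in> carrier (semigroup_ring A)"
    then show "\<exists>y\<in>carrier (semigroup_ring A). y \<oplus>\<^bsub>semigroup_ring A\<^esub> x = \<zero>\<^bsub>semigroup_ring A\<^esub>"
      by (intro bexI[of _ "- x"]) auto
  qed (auto simp: ac_simps)
  show "comm_monoid (semigroup_ring A :: (int ^ 'd::finite \<Rightarrow>\<^sub>0 'k::field) ring)"
  proof (rule comm_monoidI)
    fix x y :: "int ^ 'd::finite \<Rightarrow>\<^sub>0 'k"
    assume "x \<in> carrier (semigroup_ring A)" "y \<in> carrier (semigroup_ring A)"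
    then show "x \<otimes>\<^bsub>semigroup_ring A\<^esub> y \<in> carrier (semigroup_ring A)"
      using keys_mult_subset[of x y "nat_span A"] nat_span_add by (simp add: subset_iff)
  qed (auto simp: ac_simps)
qed (auto simp: distrib_right)

lemma sum_singles:
  "p = (\<Sum>k\<in>keys p. Poly_Mapping.single k (lookup p k))"
  by (rule poly_mapping_eqI) (auto simp: lookup_sum lookup_single when_def in_keys_iff)

definition restr :: "'a set \<Rightarrow> ('a \<Rightarrow>\<^sub>0 'k::comm_monoid_add) \<Rightarrow> 'a \<Rightarrow>\<^sub>0 'k" where
  "restr X p = (\<Sum>k\<in>keys p \<inter> X. Poly_Mapping.single k (lookup p k))"

lemma lookup_restr: "lookup (restr X p) k = (if k \<in> X then lookup p k else 0)"
  by (auto simp: restr_def lookup_sum lookup_single when_def in_keys_iff)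

lemma keys_restr: "keys (restr X p) = keys p \<inter> X"
  by (auto simp: in_keys_iff lookup_restr split: if_splits)

lemma restr_split: "p = restr X p + restr (- X) p"
  by (rule poly_mapping_eqI) (auto simp: lookup_add lookup_restr)

definition supported :: "(int ^ 'd::finite) set \<Rightarrow> ((int ^ 'd) \<Rightarrow>\<^sub>0 'k::field) set" where
  "supported U = {p. keys p \<subseteq> U}"

lemma sum_in_ideal:
  assumes "ideal K (semigroup_ring A)" "finite X" "\<And>x. x \<in> X \<Longrightarrow> g x \<in> K"
  shows "sum g X \<in> K"
proof -
  interpret ideal K "semigroup_ring A" by fact
  show ?thesis using assms(2,3)
    by (induction X rule: finite_induct)
      (use additive_subgroup.a_closed[OF is_additive_subgroup] additive_subgroup.zero_closed[OF is_additive_subgroup] in auto)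
qed

lemma ideal_supported:
  assumes "U \<subseteq> nat_span A" "\<And>a h. a \<in> U \<Longrightarrow> h \<in> nat_span A \<Longrightarrow> a + h \<in> U"
  shows "ideal (supported U :: (int ^ 'd::finite \<Rightarrow>\<^sub>0 'k::field) set) (semigroup_ring A)"
proof -
  interpret R: cring "semigroup_ring A :: (int ^ 'd \<Rightarrow>\<^sub>0 'k) ring" by (rule cring_semigroup_ring)
  show ?thesis
  proof (rule idealI[OF R.ring_axioms])
    show "subgroup (supported U :: (int ^ 'd \<Rightarrow>\<^sub>0 'k) set) (add_monoid (semigroup_ring A))"
    proof (rule R.add.subgroupI)
      show "(supported U :: (int ^ 'd \<Rightarrow>\<^sub>0 'k) set) \<subseteq> carrier (semigroup_ring A)"
        using assms(1) by (auto simp: supported_def)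
      show "(supported U :: (int ^ 'd \<Rightarrow>\<^sub>0 'k) set) \<noteq> {}"
        by (auto simp: supported_def intro!: exI[of _ 0])
      fix p q :: "int ^ 'd \<Rightarrow>\<^sub>0 'k" assume p: "p \<in> supported U"
      have "\<ominus>\<^bsub>semigroup_ring A\<^esub> p = - p"
        using p assms(1) by (intro R.minus_equality) (auto simp: supported_def)
      then show "\<ominus>\<^bsub>semigroup_ring A\<^esub> p \<in> supported U" using p by (simp add: supported_def)
      assume q: "q \<in> supported U"
      show "p \<oplus>\<^bsub>semigroup_ring A\<^esub> q \<in> supported U"
        using p q keys_add[of p q] by (auto simp: supported_def)
    qed
    fix p x :: "int ^ 'd \<Rightarrow>\<^sub>0 'k" assume p: "p \<in> supported U" "x \<in> carrier (semigroup_ring A)"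
    then have "p * x \<in> supported U"
      unfolding supported_def using keys_mult_subset[of p x U] assms(2) by (simp add: subset_iff)
    then show "p \<otimes>\<^bsub>semigroup_ring A\<^esub> x \<in> supported U" "x \<otimes>\<^bsub>semigroup_ring A\<^esub> p \<in> supported U"
      by (simp_all add: mult.commute)
  qed
qed

lemma minus_semigroup_ring:
  assumes "p \<in> carrier (semigroup_ring A)" "q \<in> carrier (semigroup_ring A)"
  shows "p \<ominus>\<^bsub>semigroup_ring A\<^esub> q = p - (q :: int ^ 'd::finite \<Rightarrow>\<^sub>0 'k::field)"
proof -
  interpret R: cring "semigroup_ring A :: (int ^ 'd \<Rightarrow>\<^sub>0 'k) ring" by (rule cring_semigroup_ring)
  have "\<ominus>\<^bsub>semigroup_ring A\<^esub> q = - q"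
    using assms by (intro R.minus_equality) auto
  then show ?thesis by (simp add: a_minus_def)
qed

lemma ideal_diff:
  fixes p q :: "int ^ 'd::finite \<Rightarrow>\<^sub>0 'k::field"
  assumes "ideal K (semigroup_ring A)" "p \<in> K" "q \<in> K"
  shows "p - q \<in> K"
proof -
  interpret ideal K "semigroup_ring A" by fact
  have "p \<ominus>\<^bsub>semigroup_ring A\<^esub> q \<in> K"
    unfolding a_minus_def using additive_subgroup.a_closed[OF is_additive_subgroup]
      additive_subgroup.a_inv_closed[OF is_additive_subgroup] assms by blast
  then show ?thesis using minus_semigroup_ring[of p A q] assms Icarr by simp
qed

lemma genideal_monomials:
  assumes "B \<subseteq> nat_span A"
  shows "genideal (semigroup_ring A) (mon ` B) =
    (supported {b + h |b h. b \<in> B \<and> h \<in> nat_span A} :: (int ^ 'd::finite \<Rightarrow>\<^sub>0 'k::field) set)"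
    (is "?I = supported ?U")
proof
  interpret R: cring "semigroup_ring A :: (int ^ 'd \<Rightarrow>\<^sub>0 'k) ring" by (rule cring_semigroup_ring)
  have "ideal (supported ?U :: (int ^ 'd \<Rightarrow>\<^sub>0 'k) set) (semigroup_ring A)"
  proof (rule ideal_supported)
    fix a h assume "a \<in> ?U" "h \<in> nat_span A"
    then show "a + h \<in> ?U" using nat_span_add by (auto simp: add.assoc) blast
  qed (use assms in auto)
  moreover have "mon ` B \<subseteq> (supported ?U :: (int ^ 'd \<Rightarrow>\<^sub>0 'k) set)"
    unfolding supported_def by (auto intro: nat_span_zero) (metis add.right_neutral nat_span_zero)
  ultimately show "?I \<subseteq> supported ?U" by (rule R.genideal_minimal)
  have B: "(mon ` B :: (int ^ 'd \<Rightarrow>\<^sub>0 'k) set) \<subseteq> carrier (semigroup_ring A)"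
    using assms by auto
  interpret J: ideal ?I "semigroup_ring A" by (rule R.genideal_ideal[OF B])
  show "supported ?U \<subseteq> ?I"
  proof
    fix p :: "int ^ 'd \<Rightarrow>\<^sub>0 'k" assume p: "p \<in> supported ?U"
    have "Poly_Mapping.single k (lookup p k) \<in> ?I" if "k \<in> keys p" for k
    proof -
      obtain b h where k: "k = b + h" "b \<in> B" "h \<in> nat_span A" using p \<open>k \<in> keys p\<close> by (auto simp: supported_def)
      have "mon b \<in> ?I" using R.genideal_self[OF B] k by blast
      then have "Poly_Mapping.single h (lookup p k) * mon b \<in> ?I"
        using J.I_l_closed[of "mon b" "Poly_Mapping.single h (lookup p k)"] k by auto
      then show ?thesis by (simp add: mult_single k add.commute)
    qed
    then have "(\<Sum>k\<in>keys p. Poly_Mapping.single k (lookup p k)) \<in> ?I"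
      by (intro sum_in_ideal[OF J.ideal_axioms]) auto
    then show "p \<in> ?I" using sum_singles[of p] by simp
  qed
qed

lemma keys_mon_mult:
  fixes p :: "int ^ 'd::finite \<Rightarrow>\<^sub>0 'k::field"
  shows "keys (mon e * p) = (+) e ` keys p"
proof
  have *: "keys (mon a * q) \<subseteq> (+) a ` keys q" for a :: "int ^ 'd" and q :: "int ^ 'd \<Rightarrow>\<^sub>0 'k"
    by (rule keys_mult_subset) simp
  show "keys (mon e * p) \<subseteq> (+) e ` keys p" by (rule *)
  have "mon (- e) * (mon e * p) = p" by (simp add: mult.assoc[symmetric] mult_single)
  then have "keys p \<subseteq> (+) (- e) ` keys (mon e * p)" using *[of "- e" "mon e * p"] by simp
  then have "(+) e ` keys p \<subseteq> (+) e ` (+) (- e) ` keys (mon e * p)" by (rule image_mono)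
  then show "(+) e ` keys p \<subseteq> keys (mon e * p)" by (simp add: image_image)
qed

text \<open>An element with the fewest elements below it is minimal.\<close>

lemma finite_preorder_minimal:
  assumes "finite X" "X \<noteq> {}" "\<And>a. below a a" "\<And>a b c. below a b \<Longrightarrow> below b c \<Longrightarrow> below a c"
  shows "\<exists>a\<in>X. \<forall>b\<in>X. below b a \<longrightarrow> below a b"
proof -
  obtain a where a: "a \<in> X" "\<And>b. b \<in> X \<Longrightarrow> card {c \<in> X. below c a} \<le> card {c \<in> X. below c b}"
    using ex_min_if_finite[of "(\<lambda>a. card {c \<in> X. below c a}) ` X"] assms(1,2) by (fastforce simp: not_less)
  have "below a b" if b: "b \<in> X" "below b a" for b
  proof (rule ccontr)
    assume "\<not> below a b"
    then have "{c \<in> X. below c b} \<subset> {c \<in> X. below c a}" using a(1) b assms(3,4) by blast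
    then have "card {c \<in> X. below c b} < card {c \<in> X. below c a}" using assms(1) by (intro psubset_card_mono) auto
    then show False using a(2)[OF b(1)] by simp
  qed
  then show ?thesis using a(1) by blast
qed

section \<open>Localization of the semigroup ring at a face\<close>

text \<open>The monoid ring of \<open>F\<close> is the quotient of the semigroup ring by the prime of \<open>F\<close>, so primality
  says that polynomials with exponents in \<open>NF\<close> multiply without zero divisors.\<close>

locale monomial_ideal_at_face =
  fixes A F :: "(int ^ 'd::finite) set" and I :: "((int ^ 'd) \<Rightarrow>\<^sub>0 'k::field) set"
  assumes finite_A: "finite A"
    and face: "is_face A F"
    and monomial: "monomial_ideal A I"
    and prime: "primeideal (face_prime A F :: ((int ^ 'd) \<Rightarrow>\<^sub>0 'k::field) set) (semigroup_ring A)"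
begin

abbreviation "N \<equiv> nat_span A"
abbreviation "NF \<equiv> nat_span F"
abbreviation "L \<equiv> int_span F"
abbreviation "P \<equiv> face_prime A F :: ((int ^ 'd) \<Rightarrow>\<^sub>0 'k) set"
abbreviation "R \<equiv> semigroup_ring A :: ((int ^ 'd) \<Rightarrow>\<^sub>0 'k) ring"

lemma F_subset: "F \<subseteq> A" and finite_F: "finite F"
  using face finite_A finite_subset by (auto simp: is_face_def)

lemma NF_N: "x \<in> NF \<Longrightarrow> x \<in> N"
  using nat_span_mono[OF finite_A F_subset] by blast

lemma NF_face: "x \<in> N \<Longrightarrow> y \<in> N \<Longrightarrow> x + y \<in> NF \<Longrightarrow> x \<in> NF"
  by (rule face_nat_span[OF finite_A face])

text \<open>If \<open>x = p - q\<close> with \<open>p\<close> and \<open>q\<close> in \<open>NF\<close>, then \<open>x + q \<in> NF\<close>, and a face is closed under summands.\<close>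

lemma N_Int_L: "x \<in> N \<Longrightarrow> x \<in> L \<Longrightarrow> x \<in> NF"
proof -
  assume x: "x \<in> N" "x \<in> L"
  then obtain p q where "p \<in> NF" "q \<in> NF" "x = p - q" unfolding int_span_eq by blast
  then show ?thesis using NF_face[of x q] x NF_N by simp
qed

lemma face_prime_eq: "P = supported (N - NF)"
proof -
  have "{b + h |b h. b \<in> N - NF \<and> h \<in> N} = N - NF"
    using NF_face by (auto intro: exI[of _ 0]) (metis add.right_neutral nat_span_zero)
  then show ?thesis unfolding face_prime_def by (subst genideal_monomials) auto
qed

lemma ideal_eq: "I = supported (N - std A I)"
proof -
  obtain B where B: "B \<subseteq> N" "I = genideal R (mon ` B)" using monomial unfolding monomial_ideal_def by blast
  then have I: "I = supported {b + h |b h. b \<in> B \<and> h \<in> N}" (is "_ = supported ?U") by (simp add: genideal_monomials)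
  have "mon a \<in> I \<longleftrightarrow> a \<in> ?U" for a unfolding I by (auto simp: supported_def)
  moreover have "?U \<subseteq> N" using B(1) by auto
  ultimately have "N - std A I = ?U" by (auto simp: std_def)
  then show ?thesis using I by simp
qed

lemma mem_nonstd: "a \<in> N \<Longrightarrow> a \<notin> std A I \<longleftrightarrow> mon a \<in> I"
  by (simp add: std_def)

lemma ideal_I: "ideal I R"
proof -
  interpret R: cring R by (rule cring_semigroup_ring)
  obtain B where B: "B \<subseteq> N" "I = genideal R (mon ` B)" using monomial unfolding monomial_ideal_def by blast
  show ?thesis unfolding B(2) by (rule R.genideal_ideal) (use B(1) in auto)
qed

lemma std_downward: "a \<in> N \<Longrightarrow> h \<in> N \<Longrightarrow> a + h \<in> std A I \<Longrightarrow> a \<in> std A I"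
proof -
  interpret I: ideal I R by (rule ideal_I)
  assume a: "a \<in> N" "h \<in> N" "a + h \<in> std A I"
  have "mon a \<notin> I"
  proof
    assume "mon a \<in> I"
    then have "mon h * mon a \<in> I" using I.I_l_closed[of "mon a" "mon h"] a by simp
    then show False using a by (simp add: mult_single std_def add.commute)
  qed
  then show ?thesis using a by (simp add: std_def)
qed

abbreviation "S \<equiv> carrier R - P"

lemma S_iff: "s \<in> S \<longleftrightarrow> keys s \<subseteq> N \<and> keys s \<inter> NF \<noteq> {}"
  unfolding face_prime_eq by (auto simp: supported_def)

lemma multiplicative_subset_S: "multiplicative_subset R S"
proof -
  interpret R: cring R by (rule cring_semigroup_ring)
  interpret P: primeideal P R by (rule prime)
  show ?thesis
  proof
    show "\<one>\<^bsub>R\<^esub> \<in> S" using P.I_notcarr P.one_imp_carrier R.one_closed by blast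
    show "s \<otimes>\<^bsub>R\<^esub> t \<in> S" if "s \<in> S" "t \<in> S" for s t
      using that P.I_prime R.m_closed by blast
  qed auto
qed

sublocale loc: localized_quotient R S I
  by (intro localized_quotient.intro multiplicative_subset_S ideal_I)

lemma saturated_iff: "loc.saturated K \<longleftrightarrow> ideal K R \<and> I \<subseteq> K \<and> (\<forall>s\<in>S. \<forall>r\<in>carrier R. s * r \<in> K \<longrightarrow> r \<in> K)"
  by (simp add: loc.saturated_def)

text \<open>A factor \<open>t\<^sup>e\<close> in the Laurent polynomial ring thus moves a polynomial supported in one class modulo
  \<open>L\<close> into the monoid ring of \<open>F\<close>.\<close>

lemma shift_into_face:
  assumes "finite X" "\<And>x. x \<in> X \<Longrightarrow> a - x \<in> L"
  shows "\<exists>e. \<forall>x\<in>X. e + x \<in> NF"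
proof -
  have "(\<lambda>x. x - a) ` X \<subseteq> L" using int_span_uminus[OF assms(2)] by auto
  then obtain f where "\<forall>y\<in>(\<lambda>x. x - a) ` X. y + f \<in> NF"
    using finite_common_denominator[of "(\<lambda>x. x - a) ` X" F] assms(1) by blast
  then have "(f - a) + x \<in> NF" if "x \<in> X" for x using that by (auto simp: algebra_simps)
  then show ?thesis by blast
qed

text \<open>Divisibility in \<open>N\<close> modulo \<open>L\<close>, on representatives of classes.\<close>

definition "below a b \<longleftrightarrow> (\<exists>h\<in>N. b - a - h \<in> L)"

lemma below_refl: "below a a" unfolding below_def by (intro bexI[of _ 0]) auto

lemma below_trans: "below a b \<Longrightarrow> below b c \<Longrightarrow> below a c"
proof -
  assume "below a b" "below b c"
  then obtain h k where hk: "h \<in> N" "k \<in> N" "b - a - h \<in> L" "c - b - k \<in> L" unfolding below_def by blast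
  then have "c - a - (h + k) \<in> L" using int_span_add[OF hk(3,4)] by (simp add: algebra_simps)
  then show ?thesis using hk unfolding below_def by (intro bexI[of _ "h + k"]) auto
qed

text \<open>The two cofactors add up to an element of \<open>N \<inter> L\<close>, that is of \<open>NF\<close>, so both lie in \<open>NF\<close>. This makes
  the classes modulo \<open>L\<close> partially ordered.\<close>

lemma below_antisym: "below a b \<Longrightarrow> below b a \<Longrightarrow> a - b \<in> L"
proof -
  assume "below a b" "below b a"
  then obtain h k where hk: "h \<in> N" "k \<in> N" "b - a - h \<in> L" "a - b - k \<in> L" unfolding below_def by blast
  then have "h + k \<in> L" using int_span_uminus[OF int_span_add[OF hk(3,4)]] by (simp add: algebra_simps)
  then have "h + k \<in> NF" using hk by (intro N_Int_L) auto
  then have "k \<in> NF" using NF_face[of k h] hk by (simp add: add.commute)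
  then have "(a - b - k) + k \<in> L" by (intro int_span_add hk(4) nat_span_int_span)
  then show ?thesis by simp
qed

definition "upset U \<longleftrightarrow> U \<subseteq> N \<and> (\<forall>a\<in>U. \<forall>b\<in>N. below a b \<longrightarrow> b \<in> U)"

lemma below_add: "h \<in> N \<Longrightarrow> below a (a + h)"
  unfolding below_def by (intro bexI[of _ h]) auto

lemma below_coset: "b - a \<in> L \<Longrightarrow> below a b"
  unfolding below_def by (intro bexI[of _ 0]) auto

lemma ideal_upset: "upset U \<Longrightarrow> ideal (supported U :: (int ^ 'd \<Rightarrow>\<^sub>0 'k) set) R"
proof (rule ideal_supported)
  fix a h assume "upset U" "a \<in> U" "h \<in> N"
  then show "a + h \<in> U" using below_add[of h a] nat_span_add[of a A h] unfolding upset_def by blast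
qed (auto simp: upset_def)

text \<open>Let \<open>a\<close> be an exponent of \<open>r\<close> outside \<open>U\<close> whose class is minimal. In the product \<open>s * r\<close>, the terms with
  exponent in the class of \<open>a\<close> come only from the part of \<open>s\<close> with exponents in \<open>NF\<close> and the part of
  \<open>r\<close> in the class of \<open>a\<close>: other terms of \<open>r\<close> lie in \<open>U\<close> or in classes that are not smaller. Both
  parts are nonzero, and so is their product because the prime of \<open>F\<close> is prime. Thus \<open>s * r\<close> has
  an exponent outside \<open>U\<close>.\<close>

lemma upset_saturated:
  assumes U: "upset U" and s: "s \<in> S" and r: "r \<in> carrier R" and sr: "s * r \<in> supported U"
  shows "r \<in> supported U"
proof (rule ccontr)
  assume "r \<notin> supported U"
  then have "keys r - U \<noteq> {}" by (auto simp: supported_def)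
  then have "\<exists>a\<in>keys r - U. \<forall>b\<in>keys r - U. below b a \<longrightarrow> below a b"
    by (intro finite_preorder_minimal) (auto intro: below_refl below_trans)
  then obtain a where a: "a \<in> keys r" "a \<notin> U" and min: "\<And>b. b \<in> keys r - U \<Longrightarrow> below b a \<Longrightarrow> below a b"
    by blast
  have aN: "a \<in> N" using a(1) r by auto
  let ?c = "{b. a - b \<in> L}"
  let ?ra = "restr ?c r" and ?sF = "restr NF s"
  have "a \<in> keys ?ra" using a by (simp add: keys_restr)
  have "\<exists>e. \<forall>x\<in>keys ?ra. e + x \<in> NF"
    by (rule shift_into_face[of _ a]) (simp_all add: keys_restr)
  then obtain e where e: "\<And>x. x \<in> keys ?ra \<Longrightarrow> e + x \<in> NF" by blast
  have disj: "k \<notin> U" if "a - k \<in> L" for k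
  proof
    assume "k \<in> U"
    then show False using U a(2) aN below_coset[OF that] unfolding upset_def by blast
  qed
  have 1: "lookup (restr (- NF) s * r) k = 0" if k: "a - k \<in> L" for k
  proof (rule ccontr)
    assume "lookup (restr (- NF) s * r) k \<noteq> 0"
    then have "k \<in> keys (restr (- NF) s * r)" by (simp add: in_keys_iff)
    then obtain h b where hb: "h \<in> keys s" "h \<notin> NF" "b \<in> keys r" "k = h + b"
      using keys_mult[of "restr (- NF) s" r] by (auto simp: keys_restr)
    have h: "h \<in> N" using hb(1) s by (auto simp: S_iff)
    have ba: "below b a" unfolding below_def using h k hb(4) by (intro bexI[of _ h]) (simp_all add: algebra_simps)
    have "b \<notin> U" using ba U aN a(2) unfolding upset_def by blast
    then have "a - b \<in> L" using min[of b] ba hb(3) below_antisym by blast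
    then have "h \<in> L" using int_span_minus[OF _ k, of "a - b"] hb(4) by simp
    then show False using N_Int_L h hb(2) by blast
  qed
  have 2: "lookup (?sF * restr (- ?c) r) k = 0" if k: "a - k \<in> L" for k
  proof (rule ccontr)
    assume "lookup (?sF * restr (- ?c) r) k \<noteq> 0"
    then have "k \<in> keys (?sF * restr (- ?c) r)" by (simp add: in_keys_iff)
    then obtain f b where fb: "f \<in> NF" "a - b \<notin> L" "k = f + b"
      using keys_mult[of ?sF "restr (- ?c) r"] by (auto simp: keys_restr)
    have "(a - k) + f \<in> L" by (intro int_span_add k nat_span_int_span fb(1))
    then show False using fb(2,3) by simp
  qed
  have "s * r = (?sF + restr (- NF) s) * r" using restr_split[of s NF] by simp
  also have "\<dots> = ?sF * (?ra + restr (- ?c) r) + restr (- NF) s * r"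
    using restr_split[of r ?c] by (simp add: distrib_right)
  finally have "s * r = ?sF * ?ra + ?sF * restr (- ?c) r + restr (- NF) s * r"
    by (simp add: distrib_left)
  then have "lookup (s * r) k = lookup (?sF * ?ra) k" if "a - k \<in> L" for k
    using 1[OF that] 2[OF that] by (simp add: lookup_add)
  moreover have "lookup (s * r) k = 0" if "a - k \<in> L" for k
    using disj[OF that] sr by (auto simp: supported_def in_keys_iff)
  moreover have "keys (?sF * ?ra) \<subseteq> ?c"
  proof (rule keys_mult_subset)
    fix f b assume "f \<in> keys ?sF" "b \<in> keys ?ra"
    then show "f + b \<in> ?c" using int_span_minus[of "a - b" F f] nat_span_int_span[of f F]
      by (auto simp: keys_restr algebra_simps)
  qed
  ultimately have zero: "?sF * ?ra = 0"
    by (intro poly_mapping_eqI) (metis (mono_tags, lifting) in_keys_iff lookup_zero mem_Collect_eq subsetD)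
  interpret P: primeideal P R by (rule prime)
  let ?q = "mon e * ?ra"
  have keys_q: "keys ?q \<subseteq> NF" using e by (intro keys_mult_subset) auto
  have "?q \<noteq> 0"
  proof
    assume "?q = 0"
    then have "mon (- e) * ?q = 0" by simp
    then have "?ra = 0" by (simp add: mult.assoc[symmetric] mult_single)
    then show False using \<open>a \<in> keys ?ra\<close> by simp
  qed
  then have q: "?q \<in> carrier R" "?q \<notin> P" using keys_q NF_N unfolding face_prime_eq supported_def
    by auto (metis DiffD2 all_not_in_conv keys_eq_empty subsetD)
  have sF: "?sF \<in> carrier R" "?sF \<notin> P"
    using s NF_N unfolding S_iff face_prime_eq supported_def by (auto simp: keys_restr)
  have "?sF * ?q = 0" using zero by (simp add: mult.left_commute)
  then have "?sF \<otimes>\<^bsub>R\<^esub> ?q \<in> P" using P.zero_closed by simp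
  then show False using P.I_prime sF q by blast
qed

end

section \<open>Length as a number of classes\<close>

context monomial_ideal_at_face begin

text \<open>The exponents of the monomials that vanish in the localization modulo \<open>I\<close>: multiplication by a
  unit \<open>t\<^sup>f\<close> moves them into \<open>I\<close>.\<close>

definition "Killed = {b \<in> N. \<exists>f\<in>NF. b + f \<notin> std A I}"

text \<open>Together with \<open>F\<close>, such an exponent is a proper pair that cannot be enlarged by enlarging the
  face. It need not be a standard pair, since its base may still be decreased along \<open>F\<close>.\<close>

definition "Torsion = {a \<in> N. a \<notin> Killed \<and>
  (\<forall>G. is_face A G \<and> F \<subset> G \<longrightarrow> \<not> (\<forall>g\<in>nat_span G. a + g \<in> std A I))}"

definition "cls a = {b \<in> N. a - b \<in> L}"

lemma belowE:
  assumes "below a b"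
  obtains h p q where "h \<in> N" "p \<in> NF" "q \<in> NF" "b + q = a + h + p"
proof -
  obtain h where h: "h \<in> N" "b - a - h \<in> L" using assms unfolding below_def by blast
  then obtain p q where "p \<in> NF" "q \<in> NF" "b - a - h = p - q" unfolding int_span_eq by blast
  then show thesis using h(1) by (intro that[of h p q]) (auto simp: algebra_simps)
qed

lemma upset_Killed: "upset Killed"
  unfolding upset_def
proof (intro conjI ballI impI)
  fix a b assume a: "a \<in> Killed" and b: "b \<in> N" "below a b"
  obtain f where f: "f \<in> NF" "a + f \<notin> std A I" using a by (auto simp: Killed_def)
  obtain h p q where hpq: "h \<in> N" "p \<in> NF" "q \<in> NF" "b + q = a + h + p" by (rule belowE[OF b(2)])
  have e: "b + (q + f) = (a + f) + (h + p)" using hpq(4) by (simp add: algebra_simps)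
  have "b + (q + f) \<notin> std A I"
    unfolding e using f a hpq NF_N std_downward[of "a + f" "h + p"] by (auto simp: Killed_def)
  then show "b \<in> Killed" using b f hpq by (auto simp: Killed_def intro!: bexI[of _ "q + f"])
qed (auto simp: Killed_def)

lemma Torsion_disjoint: "Torsion \<inter> Killed = {}" and Torsion_subset: "Torsion \<subseteq> N"
  by (auto simp: Torsion_def)

text \<open>If \<open>a\<close> divides \<open>b\<close> modulo \<open>L\<close>, then a proper pair \<open>(b, G)\<close> with \<open>F \<subseteq> G\<close> yields the proper pair
  \<open>(a, G)\<close>, because divisors of standard monomials are standard.\<close>

lemma upset_Killed_Torsion: "upset (Killed \<union> Torsion)"
  unfolding upset_def
proof (intro conjI ballI impI)
  fix a b assume a: "a \<in> Killed \<union> Torsion" and b: "b \<in> N" "below a b"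
  show "b \<in> Killed \<union> Torsion"
  proof (cases "a \<in> Killed \<or> b \<in> Killed")
    case True
    then show ?thesis using upset_Killed b unfolding upset_def by blast
  next
    case False
    then have aT: "a \<in> Torsion" using a by blast
    obtain h p q where hpq: "h \<in> N" "p \<in> NF" "q \<in> NF" "b + q = a + h + p" by (rule belowE[OF b(2)])
    have "\<not> (\<forall>g\<in>nat_span G. b + g \<in> std A I)" if G: "is_face A G" "F \<subset> G" for G
    proof
      assume all: "\<forall>g\<in>nat_span G. b + g \<in> std A I"
      have finG: "finite G" "G \<subseteq> A" using G finite_A finite_subset by (auto simp: is_face_def)
      have "a + g \<in> std A I" if g: "g \<in> nat_span G" for g
      proof -
        have "q \<in> nat_span G" using nat_span_mono[OF finG(1)] G(2) hpq(3) by blast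
        then have "b + (q + g) \<in> std A I" using all g by simp
        moreover have "b + (q + g) = (a + g) + (h + p)" using hpq(4) by (simp add: algebra_simps)
        moreover have "a + g \<in> N" "h + p \<in> N"
          using aT Torsion_subset g nat_span_mono[OF finite_A finG(2)] hpq NF_N by (auto intro!: nat_span_add)
        ultimately show ?thesis using std_downward by metis
      qed
      then show False using aT G unfolding Torsion_def by blast
    qed
    then show ?thesis using b False by (auto simp: Torsion_def)
  qed
qed (auto simp: Killed_def Torsion_def)

lemma Torsion_coset: "a \<in> Torsion \<Longrightarrow> b \<in> N \<Longrightarrow> a - b \<in> L \<Longrightarrow> b \<in> Torsion"
proof -
  assume a: "a \<in> Torsion" and b: "b \<in> N" "a - b \<in> L"
  have "b - a \<in> L" using int_span_uminus[OF b(2)] by simp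
  then have "b \<in> Killed \<union> Torsion" using upset_Killed_Torsion a b below_coset unfolding upset_def by blast
  moreover have "b \<notin> Killed"
  proof
    assume "b \<in> Killed"
    then have "a \<in> Killed" using upset_Killed below_coset[OF b(2)] a Torsion_subset unfolding upset_def by blast
    then show False using a Torsion_disjoint by blast
  qed
  ultimately show ?thesis by blast
qed

lemma cls_eq_iff: "a \<in> N \<Longrightarrow> b \<in> N \<Longrightarrow> cls a = cls b \<longleftrightarrow> a - b \<in> L"
proof
  assume ab: "a \<in> N" "b \<in> N" "cls a = cls b"
  have "b \<in> cls b" using ab(2) by (simp add: cls_def)
  then have "b \<in> cls a" unfolding ab(3) .
  then show "a - b \<in> L" by (simp add: cls_def)
next
  assume ab: "a \<in> N" "b \<in> N" "a - b \<in> L"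
  have "a - x \<in> L \<longleftrightarrow> b - x \<in> L" for x
    using int_span_add[OF ab(3), of "b - x"] int_span_minus[OF _ ab(3), of "a - x"] by auto
  then show "cls a = cls b" by (simp add: cls_def)
qed

lemma I_supported_Killed: "I \<subseteq> supported Killed"
proof -
  have "N - std A I \<subseteq> Killed" by (auto simp: Killed_def intro!: bexI[of _ 0])
  then show ?thesis by (subst ideal_eq) (auto simp: supported_def)
qed

lemma saturated_supported: "upset U \<Longrightarrow> Killed \<subseteq> U \<Longrightarrow> loc.saturated (supported U)"
proof -
  assume U: "upset U" "Killed \<subseteq> U"
  have "I \<subseteq> supported U" using I_supported_Killed U(2) unfolding supported_def by blast
  then show ?thesis using ideal_upset[OF U(1)] upset_saturated[OF U(1)] unfolding saturated_iff by blast
qed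

text \<open>The span of the killed monomials is the least saturated ideal above \<open>I\<close>; it corresponds to the
  zero ideal of the localized quotient.\<close>

lemma supported_Killed_saturated:
  assumes "loc.saturated K"
  shows "supported Killed \<subseteq> K"
proof
  fix p :: "(int ^ 'd) \<Rightarrow>\<^sub>0 'k" assume p: "p \<in> supported Killed"
  have K: "ideal K R" "I \<subseteq> K" "\<And>s r. s \<in> S \<Longrightarrow> r \<in> carrier R \<Longrightarrow> s * r \<in> K \<Longrightarrow> r \<in> K"
    using assms unfolding saturated_iff by blast+
  have "Poly_Mapping.single k (lookup p k) \<in> K" if k: "k \<in> keys p" for k
  proof -
    obtain f where f: "k \<in> N" "f \<in> NF" "k + f \<notin> std A I"
      using p k by (auto simp: supported_def Killed_def)
    have "mon (k + f) \<in> I" using f NF_N mem_nonstd by simp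
    then have "Poly_Mapping.single 0 (lookup p k) * mon (k + f) \<in> I"
      using loc.I_l_closed[of "mon (k + f)" "Poly_Mapping.single 0 (lookup p k)"] by simp
    then have "mon f * Poly_Mapping.single k (lookup p k) \<in> K"
      using K(2) by (auto simp: mult_single add.commute)
    moreover have "mon f \<in> S" unfolding S_iff using f NF_N by simp
    moreover have "Poly_Mapping.single k (lookup p k) \<in> carrier R" using f by simp
    ultimately show ?thesis using K(3) by blast
  qed
  then have "(\<Sum>k\<in>keys p. Poly_Mapping.single k (lookup p k)) \<in> K"
    by (intro sum_in_ideal[OF K(1)]) auto
  then show "p \<in> K" using sum_singles[of p] by simp
qed

lemma saturated_Int: "loc.saturated K \<Longrightarrow> loc.saturated K' \<Longrightarrow> loc.saturated (K \<inter> K')"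
proof -
  assume "loc.saturated K" "loc.saturated K'"
  then show ?thesis unfolding saturated_iff using loc.i_intersect[of K K'] by blast
qed

text \<open>The parts of \<open>k\<close> and \<open>r\<close> in the class of \<open>a\<close> can be shifted by a common monomial into the monoid
  ring of \<open>F\<close>. The shifted parts, crosswise used as multipliers, cancel the class; the one obtained
  from \<open>k\<close> is nonzero and therefore belongs to \<open>S\<close>.\<close>

lemma cancel_class:
  assumes W': "upset W'" and W: "W \<subseteq> W' \<union> cls a"
    and k: "k \<in> supported W" "k \<notin> supported W'" and r: "r \<in> supported W"
  shows "\<exists>s\<in>S. \<exists>c\<in>carrier R. s * r - c * k \<in> supported W'"
proof -
  let ?k = "restr (cls a) k" and ?r = "restr (cls a) r"
  have "\<exists>e. \<forall>x\<in>keys ?k \<union> keys ?r. e + x \<in> NF"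
    by (rule shift_into_face[of _ a]) (auto simp: keys_restr cls_def)
  then obtain e where e: "\<And>x. x \<in> keys ?k \<union> keys ?r \<Longrightarrow> e + x \<in> NF" by blast
  define s where "s = mon e * ?k"
  define c where "c = mon e * ?r"
  have ks: "keys s \<subseteq> NF" "keys c \<subseteq> NF"
    unfolding s_def c_def by (rule keys_mult_subset; use e in simp)+
  have "?k \<noteq> 0"
  proof
    assume "?k = 0"
    then have "keys k \<inter> cls a = {}" using keys_restr[of "cls a" k] by simp
    then show False using k W by (auto simp: supported_def)
  qed
  moreover have "mon (- e) * s = ?k" by (simp add: s_def mult.assoc[symmetric] mult_single)
  ultimately have "s \<noteq> 0" by auto
  then have "keys s \<noteq> {}" by simp
  then have s: "s \<in> S" using ks(1) NF_N unfolding S_iff by blast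
  have c: "c \<in> carrier R" using ks(2) NF_N by auto
  interpret W': ideal "supported W'" R by (rule ideal_upset[OF W'])
  have rest: "restr (- cls a) p \<in> supported W'" if "p \<in> supported W" for p :: "(int ^ 'd) \<Rightarrow>\<^sub>0 'k"
    using that W by (auto simp: supported_def keys_restr)
  have "s * restr (- cls a) r \<in> supported W'" "c * restr (- cls a) k \<in> supported W'"
    using W'.I_l_closed[OF rest[OF r], of s] W'.I_l_closed[OF rest[OF k(1)], of c] s c by auto
  then have "s * restr (- cls a) r - c * restr (- cls a) k \<in> supported W'"
    by (rule ideal_diff[OF W'.ideal_axioms])
  also have "s * restr (- cls a) r - c * restr (- cls a) k =
      s * (?r + restr (- cls a) r) - c * (?k + restr (- cls a) k)"
    by (simp add: distrib_left s_def c_def mult.assoc mult.commute[of ?k ?r])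
  also have "\<dots> = s * r - c * k" using restr_split[of r "cls a"] restr_split[of k "cls a"] by simp
  finally show ?thesis using s c by blast
qed

text \<open>Removing a class that is minimal among those of \<open>W - U\<close> keeps the upward closure.\<close>

lemma strip_minimal_class:
  assumes U: "upset U" and W: "upset W" and "U \<subset> W" and fin: "finite (cls ` (W - U))"
  shows "\<exists>a\<in>W - U. upset (W - cls a) \<and> U \<subseteq> W - cls a \<and> cls ` (W - cls a - U) = cls ` (W - U) - {cls a}"
proof -
  obtain X where X: "X \<subseteq> W - U" "finite X" "cls ` (W - U) = cls ` X"
    using finite_subset_image[OF fin subset_refl] by blast
  have "X \<noteq> {}" using X(3) \<open>U \<subset> W\<close> by auto
  then obtain a where a: "a \<in> X" "\<And>b. b \<in> X \<Longrightarrow> below b a \<Longrightarrow> below a b"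
    using finite_preorder_minimal[OF X(2), of below] below_refl below_trans by metis
  have WN: "W \<subseteq> N" using W by (auto simp: upset_def)
  have min: "a - b \<in> L" if b: "b \<in> W - U" "below b a" for b
  proof -
    obtain b' where b': "b' \<in> X" "cls b = cls b'" using X(3) b(1) by blast
    have "b - b' \<in> L" using b' b(1) X(1) WN by (subst cls_eq_iff[symmetric]) auto
    moreover from this have "b' - b \<in> L" using int_span_uminus by fastforce
    ultimately have "below b' b" "below b b'" using below_coset by auto
    then have "below a b" using a(2)[OF b'(1)] b(2) below_trans by blast
    then show ?thesis using b(2) below_antisym by blast
  qed
  have aWU: "a \<in> W - U" using a X by blast
  have up: "upset (W - cls a)" unfolding upset_def
  proof (intro conjI ballI impI)
    fix b c assume b: "b \<in> W - cls a" and c: "c \<in> N" "below b c"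
    have "c \<in> W" using W b c unfolding upset_def by blast
    moreover have "c \<notin> cls a"
    proof
      assume ca: "c \<in> cls a"
      then have ba: "below b a" using below_trans[OF c(2) below_coset] by (simp add: cls_def)
      have "b \<notin> U" using U ba aWU WN unfolding upset_def by blast
      then have "a - b \<in> L" using min[OF _ ba] b by blast
      then show False using b WN by (auto simp: cls_def)
    qed
    ultimately show "c \<in> W - cls a" by blast
  qed (use WN in blast)
  have "U \<inter> cls a = {}"
  proof -
    have "a \<in> U" if "x \<in> U" "x \<in> cls a" for x
      using U that below_coset[of a x] aWU WN unfolding upset_def cls_def by blast
    then show ?thesis using aWU by blast
  qed
  then have "U \<subseteq> W - cls a" using \<open>U \<subset> W\<close> by blast
  moreover have "cls ` (W - cls a - U) = cls ` (W - U) - {cls a}"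
  proof -
    have "b \<in> cls a \<longleftrightarrow> cls b = cls a" if "b \<in> W - U" for b
      using cls_eq_iff[of a b] that aWU WN by (auto simp: cls_def)
    then show ?thesis by blast
  qed
  ultimately show ?thesis using up aWU by blast
qed

text \<open>The rank of \<open>K\<close> counts the classes of \<open>W - U\<close> that occur as leading classes of elements of \<open>K\<close> when the
  classes are stripped off one at a time. If \<open>K \<subset> K'\<close> had the same leading classes, then
  \<open>cancel_class\<close> would reduce every element of \<open>K'\<close> to one of \<open>K\<close>. So a chain between the two
  spans is no longer than the number of classes.\<close>

lemma rank_exists:
  assumes U: "upset U" "Killed \<subseteq> U"
  shows "upset W \<Longrightarrow> U \<subseteq> W \<Longrightarrow> finite (cls ` (W - U)) \<Longrightarrow> card (cls ` (W - U)) = n \<Longrightarrow>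
    \<exists>\<rho>::((int ^ 'd) \<Rightarrow>\<^sub>0 'k) set \<Rightarrow> nat. (\<forall>K. \<rho> K \<le> n) \<and>
      (\<forall>K K'. loc.saturated K \<longrightarrow> loc.saturated K' \<longrightarrow> supported U \<subseteq> K \<longrightarrow> K \<subset> K' \<longrightarrow> K' \<subseteq> supported W \<longrightarrow> \<rho> K < \<rho> K')"
proof (induction n arbitrary: W)
  case 0
  then have "W = U" by auto
  then show ?case by (intro exI[of _ "\<lambda>_. 0"]) auto
next
  case (Suc n)
  then have "U \<subset> W" by auto
  then obtain a where a: "a \<in> W - U" "upset (W - cls a)" "U \<subseteq> W - cls a"
    and cl: "cls ` (W - cls a - U) = cls ` (W - U) - {cls a}"
    using strip_minimal_class[OF U(1) Suc.prems(1) _ Suc.prems(3)] by blast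
  let ?W = "W - cls a"
  have "card (cls ` (?W - U)) = n" "finite (cls ` (?W - U))"
    unfolding cl using Suc.prems(3,4) a(1) by auto
  then obtain \<rho> :: "((int ^ 'd) \<Rightarrow>\<^sub>0 'k) set \<Rightarrow> nat" where \<rho>: "\<And>K. \<rho> K \<le> n"
    "\<And>K K'. loc.saturated K \<Longrightarrow> loc.saturated K' \<Longrightarrow> supported U \<subseteq> K \<Longrightarrow> K \<subset> K' \<Longrightarrow> K' \<subseteq> supported ?W \<Longrightarrow> \<rho> K < \<rho> K'"
    using Suc.IH[OF a(2,3)] by blast
  let ?M = "supported ?W :: ((int ^ 'd) \<Rightarrow>\<^sub>0 'k) set"
  have satM: "loc.saturated ?M" using saturated_supported[OF a(2)] U a(3) by blast
  have UM: "supported U \<subseteq> ?M" using a(3) by (auto simp: supported_def)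
  \<comment> \<open>The stripped class is a leading class of \<open>K\<close> exactly if \<open>K\<close> is not contained in the smaller span.\<close>
  define \<rho>' where "\<rho>' K = \<rho> (K \<inter> ?M) + (if K \<subseteq> ?M then 0 else 1)" for K
  have "\<rho>' K < \<rho>' K'" if K: "loc.saturated K" "loc.saturated K'" "supported U \<subseteq> K" "K \<subset> K'" "K' \<subseteq> supported W" for K K'
  proof (cases "K \<inter> ?M = K' \<inter> ?M")
    case False
    then have "\<rho> (K \<inter> ?M) < \<rho> (K' \<inter> ?M)"
      using K UM by (intro \<rho>(2) saturated_Int satM) blast+
    moreover have "K' \<subseteq> ?M \<Longrightarrow> K \<subseteq> ?M" using K(4) by blast
    ultimately show ?thesis by (auto simp: \<rho>'_def)
  next
    case True
    obtain r where r: "r \<in> K'" "r \<notin> K" using K(4) by blast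
    then have "\<not> K' \<subseteq> ?M" using True by blast
    moreover have "K \<subseteq> ?M"
    proof (rule ccontr)
      assume "\<not> K \<subseteq> ?M"
      then obtain k where k: "k \<in> K" "k \<notin> ?M" by blast
      have Ki: "ideal K R" "ideal K' R" and saturated: "\<And>s r. s \<in> S \<Longrightarrow> r \<in> carrier R \<Longrightarrow> s * r \<in> K \<Longrightarrow> r \<in> K"
        using K unfolding saturated_iff by blast+
      interpret K: ideal K R by (rule Ki)
      interpret K': ideal K' R by (rule Ki)
      have "\<exists>s\<in>S. \<exists>c\<in>carrier R. s * r - c * k \<in> ?M"
        by (rule cancel_class[OF a(2), of W a]) (use k r K in auto)
      then obtain s c where sc: "s \<in> S" "c \<in> carrier R" "s * r - c * k \<in> ?M" by blast
      have ck: "c * k \<in> K" using K.I_l_closed[OF k(1) sc(2)] by simp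
      have "s * r \<in> K'" using K'.I_l_closed[OF r(1), of s] sc(1) by simp
      then have "s * r - c * k \<in> K'" using ck K(4) by (intro ideal_diff[OF Ki(2)]) auto
      then have "s * r - c * k \<in> K" using sc(3) True by blast
      then have "s * r - c * k \<oplus>\<^bsub>R\<^esub> c * k \<in> K"
        using ck additive_subgroup.a_closed[OF K.is_additive_subgroup] by blast
      then have "s * r \<in> K" by simp
      then show False using saturated[OF sc(1)] r K'.Icarr by blast
    qed
    ultimately show ?thesis using True by (simp add: \<rho>'_def)
  qed
  moreover have "\<rho>' K \<le> Suc n" for K using \<rho>(1)[of "K \<inter> ?M"] by (simp add: \<rho>'_def)
  ultimately show ?case by (intro exI[of _ \<rho>']) simp
qed

text \<open>Stripping off the classes one at a time also gives a chain that attains this bound.\<close>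

lemma upset_chain_exists:
  assumes U: "upset U"
  shows "upset W \<Longrightarrow> U \<subseteq> W \<Longrightarrow> finite (cls ` (W - U)) \<Longrightarrow> card (cls ` (W - U)) = n \<Longrightarrow>
    \<exists>C. (\<forall>i\<le>n. upset (C i) \<and> U \<subseteq> C i \<and> C i \<subseteq> W) \<and> (\<forall>i<n. C i \<subset> C (Suc i))"
proof (induction n arbitrary: W)
  case 0
  then show ?case by (intro exI[of _ "\<lambda>_. W"]) auto
next
  case (Suc n)
  then have "U \<subset> W" by auto
  then obtain a where a: "a \<in> W - U" "upset (W - cls a)" "U \<subseteq> W - cls a"
    and cl: "cls ` (W - cls a - U) = cls ` (W - U) - {cls a}"
    using strip_minimal_class[OF U(1) Suc.prems(1) _ Suc.prems(3)] by blast
  have "card (cls ` (W - cls a - U)) = n" "finite (cls ` (W - cls a - U))"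
    unfolding cl using Suc.prems(3,4) a(1) by auto
  then obtain C where C: "\<forall>i\<le>n. upset (C i) \<and> U \<subseteq> C i \<and> C i \<subseteq> W - cls a" "\<forall>i<n. C i \<subset> C (Suc i)"
    using Suc.IH[OF a(2,3)] by blast
  have "a \<in> cls a" using a(1) Suc.prems(1) by (auto simp: cls_def upset_def)
  then have "C n \<subset> W" using C(1) a(1) by blast
  then show ?case using C Suc.prems
    by (intro exI[of _ "C(Suc n := W)"]) (auto simp: less_Suc_eq le_Suc_eq)
qed

lemma supported_strict: "U \<subset> W \<Longrightarrow> supported U \<subset> (supported W :: ((int ^ 'd) \<Rightarrow>\<^sub>0 'k) set)"
proof -
  assume UW: "U \<subset> W"
  then obtain x where x: "x \<in> W" "x \<notin> U" by blast
  then have "(mon x :: (int ^ 'd) \<Rightarrow>\<^sub>0 'k) \<in> supported W" "(mon x :: (int ^ 'd) \<Rightarrow>\<^sub>0 'k) \<notin> supported U"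
    by (auto simp: supported_def)
  then have "supported U \<noteq> (supported W :: ((int ^ 'd) \<Rightarrow>\<^sub>0 'k) set)" by blast
  then show ?thesis using UW by (auto simp: supported_def)
qed

lemma mon_power: "(mon x :: (int ^ 'd) \<Rightarrow>\<^sub>0 'k) [^]\<^bsub>R\<^esub> (n::nat) = mon (int n *s x)"
  by (induction n) (auto simp: nat_pow_def mult_single vector_sadd_rdistrib add.commute)

text \<open>An exponent \<open>b\<close> of \<open>r \<in> K\<close> that is neither killed nor torsion lies in a translate
  \<open>b + nat_span G\<close> of standard monomials with \<open>F \<subset> G\<close>. For \<open>x \<in> G - F\<close> the monomial of \<open>x\<close> belongs to the
  maximal ideal of the localization, but none of its powers kills \<open>r\<close>, since \<open>b + n x\<close>
  stays unkilled.\<close>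

lemma unbounded_chain:
  assumes K: "loc.saturated K" "\<not> K \<subseteq> supported (Killed \<union> Torsion)"
  shows "loc.saturated_chain m K"
proof -
  interpret P: primeideal P R by (rule prime)
  have Ki: "ideal K R" using K unfolding saturated_iff by blast
  obtain r where r: "r \<in> K" "r \<notin> supported (Killed \<union> Torsion)" using K(2) by blast
  then obtain b where b: "b \<in> keys r" "b \<notin> Killed" "b \<notin> Torsion" by (auto simp: supported_def)
  have rR: "r \<in> carrier R" using ideal.Icarr[OF Ki r(1)] .
  then have bN: "b \<in> N" using b(1) by auto
  then obtain G where G: "is_face A G" "F \<subset> G" "\<And>g. g \<in> nat_span G \<Longrightarrow> b + g \<in> std A I"
    using b unfolding Torsion_def by blast
  have finG: "finite G" "G \<subseteq> A" using G finite_A finite_subset by (auto simp: is_face_def)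
  obtain x where x: "x \<in> G" "x \<notin> F" using G(2) by blast
  have xN: "x \<in> N" using x finG finite_A by (auto intro!: nat_span_base)
  have "x \<notin> NF"
    using x finG face real_vec_nat_span[of x F] unfolding is_face_def by blast
  then have xP: "mon x \<in> P" using xN by (simp add: face_prime_eq supported_def)
  show ?thesis
  proof (rule loc.descending_chain[OF K(1) r(1)])
    show xR: "mon x \<in> carrier R" using xN by simp
    fix s c assume s: "s \<in> S" and c: "c \<in> carrier R"
    have cx: "c * mon x \<in> P" using P.I_l_closed[OF xP c] by simp
    then have cxR: "c * mon x \<in> carrier R" using P.Icarr by blast
    have sR: "s \<in> carrier R" using s by blast
    have e: "s \<ominus>\<^bsub>R\<^esub> c \<otimes>\<^bsub>R\<^esub> mon x = s - c * mon x" using minus_semigroup_ring[OF sR cxR] by simp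
    have "s - c * mon x \<notin> P"
    proof
      assume "s - c * mon x \<in> P"
      then have "(s - c * mon x) \<oplus>\<^bsub>R\<^esub> c * mon x \<in> P"
        using cx additive_subgroup.a_closed[OF P.is_additive_subgroup] by blast
      then show False using s by simp
    qed
    moreover have "s - c * mon x \<in> carrier R" using loc.minus_closed[OF sR cxR] e by simp
    ultimately show "s \<ominus>\<^bsub>R\<^esub> c \<otimes>\<^bsub>R\<^esub> mon x \<in> S" unfolding e by blast
  next
    fix n :: nat and t assume t: "t \<in> S"
    show "t \<otimes>\<^bsub>R\<^esub> (mon x [^]\<^bsub>R\<^esub> n \<otimes>\<^bsub>R\<^esub> r) \<notin> I"
    proof
      assume "t \<otimes>\<^bsub>R\<^esub> (mon x [^]\<^bsub>R\<^esub> n \<otimes>\<^bsub>R\<^esub> r) \<in> I"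
      then have *: "t * (mon (int n *s x) * r) \<in> supported Killed"
        using I_supported_Killed by (auto simp: mon_power)
      have "mon (int n *s x) * r \<in> carrier R"
        using loc.m_closed[of "mon (int n *s x)" r] rR nat_span_scale[OF xN, of n] by simp
      then have "mon (int n *s x) * r \<in> supported Killed"
        by (rule upset_saturated[OF upset_Killed t _ *])
      moreover have "int n *s x + b \<in> keys (mon (int n *s x) * r)"
        using b(1) by (simp add: keys_mon_mult)
      ultimately have "b + int n *s x \<in> Killed" by (auto simp: supported_def add.commute)
      then obtain f where f: "f \<in> NF" "b + (int n *s x + f) \<notin> std A I" by (auto simp: Killed_def add.assoc)
      have "int n *s x + f \<in> nat_span G"
      proof (rule nat_span_add)
        show "int n *s x \<in> nat_span G" using x(1) finG(1) by (intro nat_span_scale nat_span_base)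
        show "f \<in> nat_span G" using nat_span_mono[OF finG(1), of F] G(2) f(1) by blast
      qed
      then show False using G(3) f by blast
    qed
  qed
qed

end

section \<open>Finitely many torsion classes\<close>

context monomial_ideal_at_face begin

text \<open>Otherwise take the smallest face \<open>G\<close> that contains \<open>F\<close> and \<open>x\<close>. Every element of \<open>nat_span G\<close>
  divides some \<open>n x + f\<close> with \<open>f \<in> NF\<close>, so \<open>a + nat_span G\<close> would consist of standard monomials.\<close>

lemma torsion_escapes:
  assumes a: "a \<in> Torsion" and x: "x \<in> A" "x \<notin> F"
  shows "\<exists>n. a + int n *s x \<in> Killed"
proof (rule ccontr)
  assume "\<not> ?thesis"
  then have good: "a + int n *s x \<notin> Killed" for n by blast
  have xN: "x \<in> N" using x finite_A by (intro nat_span_base)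
  have aN: "a \<in> N" using a Torsion_subset by blast
  have std: "a + (int n *s x + f) \<in> std A I" if "f \<in> NF" for n f
    using good[of n] that xN aN nat_span_scale[OF xN, of n] by (auto simp: Killed_def add.assoc)
  \<comment> \<open>The submonoid whose divisors cut out the smallest face containing \<open>F\<close> and \<open>x\<close>.\<close>
  define W where "W = {int n *s x + f |n f. f \<in> NF}"
  have W_N: "W \<subseteq> N" using nat_span_scale[OF xN] NF_N by (auto simp: W_def intro!: nat_span_add)
  have W_0: "0 \<in> W" unfolding W_def by (intro CollectI exI[of _ 0]) simp
  have W_add: "v + w \<in> W" if vw: "v \<in> W" "w \<in> W" for v w
  proof -
    obtain n f k g where "v = int n *s x + f" "w = int k *s x + g" "f \<in> NF" "g \<in> NF"
      using vw by (auto simp: W_def)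
    then show ?thesis unfolding W_def
      by (intro CollectI exI[of _ "n + k"] exI[of _ "f + g"]) (auto simp: vector_sadd_rdistrib)
  qed
  define D where "D = {y \<in> N. \<exists>h\<in>N. y + h \<in> W}"
  have G: "is_face A (D \<inter> A)" "nat_span (D \<inter> A) \<subseteq> D"
    unfolding D_def by (rule face_generated[OF finite_A W_N W_0 W_add]; assumption)+
  have "f \<in> D" if "f \<in> F" for f
  proof -
    have "f \<in> NF" using that finite_F by (intro nat_span_base)
    then have "f + 0 \<in> W" unfolding W_def by (intro CollectI exI[of _ 0] exI[of _ f]) simp
    then show ?thesis using \<open>f \<in> NF\<close> NF_N nat_span_zero unfolding D_def by blast
  qed
  moreover have "x \<in> D"
  proof -
    have "x + 0 \<in> W" unfolding W_def by (intro CollectI exI[of _ 1] exI[of _ 0]) simp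
    then show ?thesis using xN nat_span_zero unfolding D_def by blast
  qed
  ultimately have "F \<subset> D \<inter> A" using F_subset x by blast
  moreover have "a + g \<in> std A I" if g: "g \<in> nat_span (D \<inter> A)" for g
  proof -
    obtain h n f where h: "g \<in> N" "h \<in> N" "f \<in> NF" "g + h = int n *s x + f"
      using subsetD[OF G(2) g] unfolding D_def W_def by blast
    then have "(a + g) + h \<in> std A I" using std[of f n] by (simp add: add.assoc)
    then show ?thesis using std_downward[of "a + g" h] aN h by simp
  qed
  ultimately show False using a G(1) unfolding Torsion_def by blast
qed

text \<open>Modulo \<open>L\<close> only the generators outside \<open>F\<close> matter, so classes are given by vectors of natural
  numbers. If infinitely many vectors gave torsion classes, some coordinate \<open>x\<close> could be increased
  arbitrarily above a fixed one among them; but adding a large multiple of \<open>x\<close> leads to killed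
  monomials, whose multiples are killed as well.\<close>

lemma finite_classes_torsion: "finite (cls ` Torsion)"
proof -
  define s where "s v = (\<Sum>y\<in>A. int (v y) *s y)" for v
  define V where "V = {v. (\<forall>y. y \<notin> A - F \<longrightarrow> v y = 0) \<and> s v \<in> Torsion}"
  have "finite V"
  proof (rule ccontr)
    assume inf: "infinite V"
    have "\<exists>v\<in>V. \<exists>x\<in>A - F. \<forall>m. \<exists>w\<in>V. v \<le> w \<and> v x + m \<le> w x"
      by (rule infinite_increasing_coordinate[OF _ inf]) (use finite_A in \<open>auto simp: V_def\<close>)
    then obtain v x where vx: "v \<in> V" "x \<in> A" "x \<notin> F" "\<And>m. \<exists>w\<in>V. v \<le> w \<and> v x + m \<le> w x" by blast
    obtain n where n: "s v + int n *s x \<in> Killed" using torsion_escapes[of "s v" x] vx by (auto simp: V_def)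
    obtain w where w: "w \<in> V" "v \<le> w" "v x + n \<le> w x" using vx(4) by blast
    \<comment> \<open>The cofactor of \<open>s v + n x\<close> in \<open>s w\<close>.\<close>
    define u where "u y = w y - v y - (if y = x then n else 0)" for y
    have "int (w y) *s y = int (v y) *s y + (if y = x then int n *s x else 0) + int (u y) *s y" for y
    proof -
      have "int (w y) = int (v y) + (if y = x then int n else 0) + int (u y)"
        using w(2,3) le_funD[OF w(2), of y] by (auto simp: u_def)
      then show ?thesis by (simp add: vector_sadd_rdistrib)
    qed
    then have "s w = s v + int n *s x + (\<Sum>y\<in>A. int (u y) *s y)"
      using finite_A vx(2) by (simp add: s_def sum.distrib)
    moreover have "(\<Sum>y\<in>A. int (u y) *s y) \<in> N" by (rule nat_spanI)
    ultimately have "below (s v + int n *s x) (s w)" using below_add by metis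
    moreover have "s w \<in> Torsion" using w(1) by (simp add: V_def)
    ultimately have "s w \<in> Killed" using upset_Killed n Torsion_subset unfolding upset_def by blast
    then show False using \<open>s w \<in> Torsion\<close> Torsion_disjoint by blast
  qed
  moreover have "cls ` Torsion \<subseteq> (\<lambda>v. cls (s v)) ` V"
  proof
    fix C assume "C \<in> cls ` Torsion"
    then obtain a where a: "a \<in> Torsion" "C = cls a" by blast
    obtain c where c: "a = (\<Sum>y\<in>A. int (c y) *s y)" using a Torsion_subset unfolding nat_span_def by blast
    define v where "v y = (if y \<in> A - F then c y else 0)" for y
    have "a = s v + (\<Sum>y\<in>A. int (if y \<in> F then c y else 0) *s y)"
      unfolding c s_def sum.distrib[symmetric] by (intro sum.cong) (auto simp: v_def)
    moreover have "(\<Sum>y\<in>A. int (if y \<in> F then c y else 0) *s y) = (\<Sum>y\<in>F. int (c y) *s y)"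
      using finite_A F_subset by (intro sum.mono_neutral_cong_right) auto
    ultimately have "a - s v \<in> L" using nat_span_int_span[OF nat_spanI[of c F]] by simp
    moreover have "s v \<in> N" unfolding s_def by (rule nat_spanI)
    ultimately have "s v \<in> Torsion" "C = cls (s v)" using Torsion_coset[OF a(1)] cls_eq_iff[of a "s v"] a Torsion_subset by auto
    then show "C \<in> (\<lambda>v. cls (s v)) ` V" by (auto simp: V_def v_def)
  qed
  ultimately show ?thesis using finite_subset by blast
qed

text \<open>The killed monomials span zero in the localization, and the torsion classes are what remains of
  the largest ideal of finite length.\<close>

lemma multiplicity_classes: "multiplicity_at R I P = enat (card (cls ` Torsion))"
proof -
  let ?J = "supported (Killed \<union> Torsion) :: ((int ^ 'd) \<Rightarrow>\<^sub>0 'k) set"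
  let ?n = "card (cls ` Torsion)"
  have diff: "Killed \<union> Torsion - Killed = Torsion" using Torsion_disjoint by blast
  have "ideal_length loc.B (THE J. largest_finite_length_ideal loc.B J) = enat ?n"
  proof (rule loc.largest_length)
    show "loc.saturated ?J" by (rule saturated_supported[OF upset_Killed_Torsion]) blast
    show "loc.saturated_chain m K" if "loc.saturated K" "\<not> K \<subseteq> ?J" for K m using that by (rule unbounded_chain)
    have "\<exists>C. (\<forall>i\<le>?n. upset (C i) \<and> Killed \<subseteq> C i \<and> C i \<subseteq> Killed \<union> Torsion) \<and> (\<forall>i<?n. C i \<subset> C (Suc i))"
      by (rule upset_chain_exists[OF upset_Killed upset_Killed_Torsion]) (simp_all add: diff finite_classes_torsion)
    then obtain C where C: "\<forall>i\<le>?n. upset (C i) \<and> Killed \<subseteq> C i \<and> C i \<subseteq> Killed \<union> Torsion" "\<forall>i<?n. C i \<subset> C (Suc i)"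
      by (elim exE conjE)
    have "\<forall>i\<le>?n. loc.saturated (supported (C i)) \<and> supported (C i) \<subseteq> ?J"
    proof (intro allI impI conjI)
      fix i assume i: "i \<le> ?n"
      show "loc.saturated (supported (C i))" using C(1) i saturated_supported by blast
      show "supported (C i) \<subseteq> ?J" using C(1) i unfolding supported_def by blast
    qed
    moreover have "\<forall>i<?n. supported (C i) \<subset> (supported (C (Suc i)) :: ((int ^ 'd) \<Rightarrow>\<^sub>0 'k) set)"
      using C(2) supported_strict by blast
    ultimately show "loc.saturated_chain ?n ?J"
      unfolding loc.saturated_chain_def by (intro exI[of _ "\<lambda>i. supported (C i)"]) blast
    fix m assume "loc.saturated_chain m ?J"
    then obtain D where D: "\<forall>i\<le>m. loc.saturated (D i) \<and> D i \<subseteq> ?J" "\<forall>i<m. D i \<subset> D (Suc i)"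
      unfolding loc.saturated_chain_def by blast
    have "\<exists>\<rho>::((int ^ 'd) \<Rightarrow>\<^sub>0 'k) set \<Rightarrow> nat. (\<forall>K. \<rho> K \<le> ?n) \<and> (\<forall>K K'. loc.saturated K \<longrightarrow> loc.saturated K' \<longrightarrow>
        supported Killed \<subseteq> K \<longrightarrow> K \<subset> K' \<longrightarrow> K' \<subseteq> ?J \<longrightarrow> \<rho> K < \<rho> K')"
      by (rule rank_exists[OF upset_Killed subset_refl upset_Killed_Torsion]) (simp_all add: diff finite_classes_torsion)
    then obtain \<rho> :: "((int ^ 'd) \<Rightarrow>\<^sub>0 'k) set \<Rightarrow> nat" where \<rho>: "\<And>K. \<rho> K \<le> ?n"
      "\<And>K K'. loc.saturated K \<Longrightarrow> loc.saturated K' \<Longrightarrow> supported Killed \<subseteq> K \<Longrightarrow> K \<subset> K' \<Longrightarrow> K' \<subseteq> ?J \<Longrightarrow> \<rho> K < \<rho> K'"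
      by blast
    have "i \<le> \<rho> (D i)" if "i \<le> m" for i
      using that
    proof (induction i)
      case (Suc i)
      have "\<rho> (D i) < \<rho> (D (Suc i))" using D Suc.prems supported_Killed_saturated by (intro \<rho>(2)) auto
      then show ?case using Suc by simp
    qed simp
    then show "m \<le> ?n" using \<rho>(1)[of "D m"] by (metis le_refl order_trans)
  qed
  moreover have "loc.B = localization_at R P Quot localized_ideal R P I"
    by (simp add: loc.B_def loc.extended_ideal_def loc.\<iota>_def localization_at_def localized_ideal_def)
  ultimately show ?thesis by (simp add: multiplicity_at_def)
qed

end

section \<open>Standard pairs and the multiplicity\<close>

context monomial_ideal_at_face begin

lemma standard_pair_Torsion: "standard_pair A I (a, F) \<Longrightarrow> a \<in> Torsion"
proof -
  assume std: "standard_pair A I (a, F)"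
  then have a: "a \<in> N" "(+) a ` NF \<subseteq> std A I"
    by (auto simp: standard_pair_def proper_pair_def pairs_def translate_of_def)
  have "\<not> (\<forall>g\<in>nat_span G. a + g \<in> std A I)" if G: "is_face A G" "F \<subset> G" for G
  proof
    assume all: "\<forall>g\<in>nat_span G. a + g \<in> std A I"
    have "finite G" using G(1) finite_A finite_subset by (auto simp: is_face_def)
    then have "NF \<subseteq> nat_span G" using nat_span_mono G(2) by blast
    then have "pair_le (a, F) (a, G)" by (auto simp: pair_le_def translate_of_def)
    moreover have "proper_pair A I (a, G)"
      using a(1) G(1) all by (auto simp: proper_pair_def pairs_def translate_of_def)
    ultimately have "(a, G) = (a, F)" using std unfolding standard_pair_def by blast
    then show False using G(2) by simp
  qed
  then show ?thesis using a by (auto simp: Torsion_def Killed_def)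
qed

text \<open>Choose the base \<open>b\<close> in the class of \<open>a\<close> such that no nonzero element of \<open>NF\<close> can be subtracted from it
  within \<open>N\<close>. A
  proper pair \<open>(c, G)\<close> above \<open>(b, F)\<close> satisfies \<open>F \<subseteq> G\<close> by the face property of \<open>G\<close>. If \<open>F = G\<close> then
  \<open>c = b\<close> by the choice of \<open>b\<close>, and a larger \<open>G\<close> contradicts that \<open>b\<close> is torsion.\<close>

lemma Torsion_standard_pair:
  assumes A: "0 \<notin> A" "contains_no_line (real_cone A)" and a: "a \<in> Torsion"
  shows "\<exists>b\<in>N. a - b \<in> L \<and> standard_pair A I (b, F)"
proof -
  have aN: "a \<in> N" using a Torsion_subset by blast
  obtain b where b: "b \<in> N" "a - b \<in> NF" "\<And>c. c \<in> N \<Longrightarrow> b - c \<in> NF \<Longrightarrow> c = b"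
    using exists_minimal_base[OF finite_A A F_subset aN] by blast
  have bT: "b \<in> Torsion" using Torsion_coset[OF a b(1) nat_span_int_span[OF b(2)]] .
  have "q = (b, F)" if q: "proper_pair A I q" "pair_le (b, F) q" for q
  proof -
    obtain c G where cG: "q = (c, G)" by (cases q)
    have c: "c \<in> N" "is_face A G" "\<And>g. g \<in> nat_span G \<Longrightarrow> c + g \<in> std A I"
      using q(1) by (auto simp: cG proper_pair_def pairs_def translate_of_def)
    have finG: "finite G" "G \<subseteq> A" using c(2) finite_A finite_subset by (auto simp: is_face_def)
    have sub: "b + f - c \<in> nat_span G" if "f \<in> NF" for f
      using q(2) that by (auto simp: cG pair_le_def translate_of_def)
    have bc: "b - c \<in> nat_span G" using sub[of 0] by simp
    then have bcN: "b - c \<in> N" using nat_span_mono[OF finite_A finG(2)] by blast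
    have "F \<subseteq> G"
    proof
      fix f assume f: "f \<in> F"
      then have "f + (b - c) \<in> nat_span G"
        using sub[OF nat_span_base[OF finite_F f]] by (simp add: algebra_simps)
      then show "f \<in> G" using face_base[OF finite_A c(2) _ bcN] f F_subset by blast
    qed
    show ?thesis
    proof (cases "F = G")
      case True
      then show ?thesis using b(3)[OF c(1)] bc cG by simp
    next
      case False
      have "b + g \<in> std A I" if "g \<in> nat_span G" for g
        using c(3)[of "(b - c) + g"] bc that by simp
      then show ?thesis using bT c(2) False \<open>F \<subseteq> G\<close> unfolding Torsion_def by blast
    qed
  qed
  moreover have "proper_pair A I (b, F)"
    using bT b(1) face by (auto simp: Torsion_def Killed_def proper_pair_def pairs_def translate_of_def)
  ultimately have "standard_pair A I (b, F)" unfolding standard_pair_def by blast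
  then show ?thesis using b nat_span_int_span by blast
qed

text \<open>An overlap class of pairs with face \<open>F\<close> is a class of exponents, each paired with \<open>F\<close>, and the
  bases of standard pairs represent exactly the torsion classes.\<close>

lemma standard_overlap_classes_eq:
  assumes A: "0 \<notin> A" "contains_no_line (real_cone A)"
  shows "standard_overlap_classes A I F = (\<lambda>c. (\<lambda>b. (b, F)) ` c) ` cls ` Torsion"
proof -
  have cl: "overlap A `` {(a, F)} = (\<lambda>b. (b, F)) ` cls a" if "a \<in> N" for a
    using that face by (auto simp: overlap_def pairs_def cls_def)
  show ?thesis
  proof (intro equalityI subsetI)
    fix C assume "C \<in> standard_overlap_classes A I F"
    then obtain p q where p: "p \<in> pairs A" "C = overlap A `` {p}" and q: "q \<in> C" "standard_pair A I q" "snd q = F"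
      unfolding standard_overlap_classes_def quotient_def by blast
    obtain a where a: "q = (a, F)" using q(3) by (cases q) auto
    have "(p, q) \<in> overlap A" using p q by blast
    then obtain a0 where a0: "p = (a0, F)" "a0 \<in> N" "a \<in> N" "a0 - a \<in> L"
      using a by (cases p) (auto simp: overlap_def pairs_def)
    have "a \<in> Torsion" using q(2) a standard_pair_Torsion by blast
    moreover have "cls a0 = cls a" using a0 cls_eq_iff by blast
    ultimately show "C \<in> (\<lambda>c. (\<lambda>b. (b, F)) ` c) ` cls ` Torsion" using p(2) a0 cl by auto
  next
    fix C assume "C \<in> (\<lambda>c. (\<lambda>b. (b, F)) ` c) ` cls ` Torsion"
    then obtain a where a: "a \<in> Torsion" "C = (\<lambda>b. (b, F)) ` cls a" by blast
    then have aN: "a \<in> N" using Torsion_subset by blast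
    obtain b where b: "b \<in> N" "a - b \<in> L" "standard_pair A I (b, F)" using Torsion_standard_pair[OF A a(1)] by blast
    have "(b, F) \<in> C" using a(2) b by (auto simp: cls_def)
    moreover have "C \<in> pairs A // overlap A"
      unfolding a(2) cl[OF aN, symmetric] using aN face by (intro quotientI) (simp add: pairs_def)
    ultimately show "C \<in> standard_overlap_classes A I F"
      using b(3) unfolding standard_overlap_classes_def by force
  qed
qed

theorem multiplicity_standard_overlap_classes:
  assumes A: "0 \<notin> A" "contains_no_line (real_cone A)"
  shows "finite (standard_overlap_classes A I F) \<and>
    multiplicity_at R I P = enat (card (standard_overlap_classes A I F))"
proof -
  have "inj_on (\<lambda>c. (\<lambda>b. (b, F)) ` c) (cls ` Torsion)" by (intro inj_onI) (auto simp: image_iff set_eq_iff)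
  then show ?thesis
    unfolding standard_overlap_classes_eq[OF A] multiplicity_classes
    using finite_classes_torsion by (simp add: card_image)
qed

end

theorem proposition3p14:
  fixes A :: "(int ^ 'd::finite) set"
    and F :: "(int ^ 'd) set"
    and I :: "((int ^ 'd) \<Rightarrow>\<^sub>0 'k::field) set"
  assumes "infinite (UNIV :: 'k set)"
    and "finite A" and "0 \<notin> A"
    and "int_span A = UNIV"
    and "contains_no_line (real_cone A)"
    and "monomial_ideal A I"
    and "is_face A F"
    and "associated_prime (semigroup_ring A) I (face_prime A F)"
  shows "finite (standard_overlap_classes A I F) \<and>
         multiplicity_at (semigroup_ring A) I (face_prime A F)
           = enat (card (standard_overlap_classes A I F))"
proof -
  interpret monomial_ideal_at_face A F I
    using assms by (intro monomial_ideal_at_face.intro) (simp_all add: associated_prime_def)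
  show ?thesis using multiplicity_standard_overlap_classes assms by blast
qed

end
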